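(* Let $f$ be an inner function with $f(0)=0$ which is not a rotation. Then there exists a constant $C=C(f)>0$ such that for any positive integer $N$, any set $\{a_{n}:n=1,\dots,N\}$ of complex numbers and any point $z\in\mathbb{D}$, we have $$ \int_{\partial\mathbb{D}}\left| \sum_{n=1}^{N} a_{n}\bigl(f^{n}(\xi)-f^{n}(z)\bigr)\right|^{2} P(z,\xi)\,dm(\xi)\le C\sum^{N}_{n=1}|a_{n}|^{2} \bigl(1-|f^{n}(z)|^{2}\bigr). $$
   Context: $\mathbb{D}$ is the open unit disc and $\partial\mathbb{D}$ the unit circle; $m$ is normalized Lebesgue measure on $\partial\mathbb{D}$ ($m(\partial\mathbb{D})=1$). $P(z,\xi)=(1-|z|^{2})|\xi-z|^{-2}$ is the Poisson kernel. An inner function is an analytic mapping $f:\mathbb{D}\to\mathbb{D}$ whose radial limits have modulus one at almost every point of $\partial\mathbb{D}$. A rotation is a map $z\mapsto \lambda z$ with $|\lambda|=1$. $f^{n}$ denotes the $n$-th iterate of $f$ (not the power), again an inner function; for almost every $\xi\in\partial\mathbb{D}$, $f^{n}(\xi)=\lim_{r\to1^-}f^{n}(r\xi)$. *)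

theory Defs
  imports "HOL-Probability.Probability" "HOL-Complex_Analysis.Complex_Analysis"
begin

definition circle_measure :: "complex measure" where
  "circle_measure =
     distr (uniform_measure lborel {0..2 * pi}) (restrict_space borel (sphere 0 1)) cis"

lemma prob_space_circle_measure: "prob_space circle_measure"
proof -
  have "prob_space (uniform_measure lborel {0..2 * pi})"
    by (intro prob_space_uniform_measure) (simp_all add: emeasure_lborel_Icc)
  moreover have "cis \<in> uniform_measure lborel {0..2 * pi} \<rightarrow>\<^sub>M restrict_space borel (sphere 0 1)"
  proof (rule measurable_restrict_space2)
    have "cis \<in> borel_measurable borel"
      by (intro borel_measurable_continuous_onI continuous_intros)
    then show "cis \<in> borel_measurable (uniform_measure lborel {0..2 * pi})"
      by (simp cong: measurable_cong_sets)
  qed auto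
  ultimately show ?thesis
    unfolding circle_measure_def by (rule prob_space.prob_space_distr)
qed

definition poisson_kernel :: "complex \<Rightarrow> complex \<Rightarrow> real" where
  "poisson_kernel z \<xi> = (1 - (cmod z)\<^sup>2) / (cmod (\<xi> - z))\<^sup>2"

text \<open>
  Maps on the open unit disc are represented by functions of type \<^typ>\<open>complex \<Rightarrow> complex\<close>
  whose values outside \<^term>\<open>ball 0 1 :: complex set\<close> play no role.
\<close>

definition inner_function :: "(complex \<Rightarrow> complex) \<Rightarrow> bool" where
  "inner_function f \<longleftrightarrow>
     f holomorphic_on ball 0 1 \<and> f ` ball 0 1 \<subseteq> ball 0 1 \<and>
     (AE \<xi> in circle_measure.
        \<exists>l. ((\<lambda>r::real. f (of_real r * \<xi>)) \<longlongrightarrow> l) (at_left 1) \<and> cmod l = 1)"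

text \<open>
  The value is meaningful only where the radial limit exists; elsewhere it is a
  fixed unspecified constant. For iterates of inner functions the exceptional set is null.
\<close>

definition radial_limit :: "(complex \<Rightarrow> complex) \<Rightarrow> complex \<Rightarrow> complex" where
  "radial_limit f \<xi> = Lim (at_left 1) (\<lambda>r::real. f (of_real r * \<xi>))"

definition is_rotation :: "(complex \<Rightarrow> complex) \<Rightarrow> bool" where
  "is_rotation f \<longleftrightarrow> (\<exists>c. cmod c = 1 \<and> (\<forall>z\<in>ball 0 1. f z = c * z))"

end

theory Submission
  imports Defs
begin

text \<open>
  Write \<open>f z = z * g z\<close> and \<open>F\<^sub>n\<close> for the \<open>n\<close>-th iterate. For \<open>k \<le> n\<close> one has \<open>F\<^sub>n = F\<^sub>k * H\<close> with
  \<open>H\<close> the product of the \<open>g \<circ> F\<^sub>i\<close>, \<open>k \<le> i < n\<close>. As \<open>F\<^sub>k\<close> is unimodular on the circle, the correlation of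
  \<open>F\<^sub>n - F\<^sub>n(z)\<close> and \<open>F\<^sub>k - F\<^sub>k(z)\<close> with respect to the Poisson kernel is \<open>(1 - |F\<^sub>k(z)|\<^sup>2) * H(z)\<close>. Since \<open>f\<close> is not
  a rotation, \<open>|g(0)| < 1\<close>, and Schwarz--Pick for \<open>g\<close> gives
  \<open>(1 - |w|\<^sup>2) * |g(w)|\<^sup>2 \<le> q\<^sup>2 * (1 - |f(w)|\<^sup>2)\<close> with \<open>q\<^sup>2 = (1 + |g(0)|) / 2\<close>. Multiplying along the orbit of \<open>z\<close>
  bounds the correlation by \<open>q\<^bsup>n - k\<^esup>\<close> times the geometric mean of \<open>1 - |F\<^sub>n(z)|\<^sup>2\<close> and \<open>1 - |F\<^sub>k(z)|\<^sup>2\<close>, and a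
  Schur test sums the geometric series.

  The iterates have radial limits by Fatou's theorem (a weak-type maximal inequality, applied to the
  Taylor remainders). They are inner: if \<open>g(0) = 0\<close> and \<open>g\<close> is inner, the boundary values of the powers of
  \<open>g\<close> are orthonormal and the coefficients of \<open>f \<circ> g\<close> against them are the Taylor coefficients of \<open>f\<close>,
  so Bessel's inequality shows that \<open>f \<circ> g\<close> has full norm on the circle.
\<close>

section \<open>The Poisson formula on the unit circle\<close>

lemma space_circle_measure [simp]: "space circle_measure = sphere 0 1"
  by (simp add: circle_measure_def space_restrict_space)

lemma sets_circle_measure [measurable_cong]:
  "sets circle_measure = sets (restrict_space borel (sphere 0 1))"
  by (simp add: circle_measure_def)

interpretation circle: prob_space circle_measure
  by (rule prob_space_circle_measure)

lemma borel_measurable_circleI: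
  fixes h :: "complex \<Rightarrow> 'a::topological_space"
  assumes "continuous_on (sphere 0 1) h"
  shows "h \<in> borel_measurable circle_measure"
  using borel_measurable_continuous_on_restrict[OF assms]
  by (simp cong: measurable_cong_sets add: sets_circle_measure)

lemma measurable_circle_id [measurable]: "(\<lambda>\<xi>. \<xi>) \<in> borel_measurable circle_measure"
  by (intro borel_measurable_circleI continuous_intros)

lemma cis_measurable_uniform:
  "cis \<in> uniform_measure lborel {0..2 * pi} \<rightarrow>\<^sub>M restrict_space borel (sphere 0 1)"
proof (rule measurable_restrict_space2)
  have "cis \<in> borel_measurable borel"
    by (intro borel_measurable_continuous_onI continuous_intros)
  then show "cis \<in> borel_measurable (uniform_measure lborel {0..2 * pi})"
    by (simp cong: measurable_cong_sets)
qed auto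

text \<open>The interval integral on the right is the form into which contour integrals over
  \<open>circlepath 0 1\<close> unfold, so that Cauchy's formula can be read as a statement about
  \<open>circle_measure\<close>.\<close>

lemma integral_circle_measure:
  fixes h :: "complex \<Rightarrow> complex"
  assumes h: "continuous_on (sphere 0 1) h"
  shows "(LINT \<xi>|circle_measure. h \<xi>) = integral {0..2 * pi} (\<lambda>t. h (cis t)) / (2 * pi)"
proof -
  have hm: "h \<in> borel_measurable (restrict_space borel (sphere 0 1))"
    by (rule borel_measurable_continuous_on_restrict[OF h])
  have um: "uniform_measure lborel {0..2 * pi}
      = density lborel (\<lambda>t. ennreal (indicator {0..2 * pi} t / (2 * pi)))"
    unfolding uniform_measure_def
    by (intro density_cong AE_I2)
       (auto simp: ennreal_divide_times divide_ennreal ennreal_indicator split: split_indicator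
          simp flip: ennreal_1 ennreal_mult'')
  have c: "continuous_on UNIV (\<lambda>t. h (cis t))"
    by (intro continuous_on_compose2[OF h] continuous_intros) auto
  then have "(\<lambda>t. h (cis t)) \<in> borel_measurable borel"
    by (rule borel_measurable_continuous_onI)
  then have hc: "(\<lambda>t. h (cis t)) \<in> borel_measurable lborel"
    by simp
  have "(LINT \<xi>|circle_measure. h \<xi>) = (LINT t|uniform_measure lborel {0..2 * pi}. h (cis t))"
    unfolding circle_measure_def by (rule integral_distr[OF cis_measurable_uniform hm])
  also have "\<dots> = (LINT t|lborel. (indicator {0..2 * pi} t / (2 * pi)) *\<^sub>R h (cis t))"
    unfolding um by (rule integral_density[OF hc]) auto
  also have "\<dots> = (LINT t|lborel. (indicator {0..2 * pi} t *\<^sub>R h (cis t)) / (2 * pi))"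
    by (intro Bochner_Integration.integral_cong) (auto simp: scaleR_conv_of_real)
  also have "\<dots> = (LINT t:{0..2 * pi}|lborel. h (cis t)) / (2 * pi)"
    unfolding set_lebesgue_integral_def by (rule integral_divide_zero)
  also have "(LINT t:{0..2 * pi}|lborel. h (cis t)) = integral {0..2 * pi} (\<lambda>t. h (cis t))"
    by (intro set_borel_integral_eq_integral borel_integrable_atLeastAtMost'
        continuous_on_subset[OF c]) auto
  finally show ?thesis .
qed

lemma poisson_kernel_nonneg: "z \<in> ball 0 1 \<Longrightarrow> poisson_kernel z \<xi> \<ge> 0"
  by (auto simp: poisson_kernel_def abs_square_le_1 power_le_one)

lemma continuous_on_poisson_kernel [continuous_intros]:
  assumes "z \<in> ball 0 1"
  shows "continuous_on (sphere 0 1) (poisson_kernel z)"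
  using assms unfolding poisson_kernel_def
  by (intro continuous_intros) auto

lemma cmod_eq_1_cnj: "cmod \<xi> = 1 \<Longrightarrow> \<xi> * cnj \<xi> = 1"
  using complex_norm_square[of \<xi>] by simp

text \<open>On the circle, \<^term>\<open>\<xi> / (\<xi> - z)\<close> is \<^term>\<open>1 / (1 - z * cnj \<xi>)\<close>, which splits
  the Poisson kernel into the Cauchy kernel and a factor holomorphic in \<^term>\<open>\<xi>\<close>.\<close>

lemma poisson_kernel_eq_cauchy:
  assumes "cmod \<xi> = 1" "cmod z < 1"
  shows "complex_of_real (poisson_kernel z \<xi>)
       = (1 - (cmod z)\<^sup>2) / (1 - cnj z * \<xi>) * \<xi> / (\<xi> - z)"
proof -
  have 1: "\<xi> * cnj \<xi> = 1" by (rule cmod_eq_1_cnj) fact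
  have "complex_of_real ((cmod (\<xi> - z))\<^sup>2) * \<xi> = (\<xi> - z) * (1 - cnj z * \<xi>)"
    unfolding complex_norm_square using 1 by (simp add: algebra_simps)
  moreover have "\<xi> - z \<noteq> 0" "\<xi> \<noteq> 0" "1 - cnj z * \<xi> \<noteq> 0"
  proof -
    show "\<xi> - z \<noteq> 0" "\<xi> \<noteq> 0" using assms by auto
    have "cmod (cnj z * \<xi>) < 1" using assms by (simp add: norm_mult)
    then show "1 - cnj z * \<xi> \<noteq> 0" by auto
  qed
  ultimately show ?thesis
    by (simp add: poisson_kernel_def divide_simps) (simp add: mult_ac)
qed

text \<open>Splitting the kernel as in \<open>poisson_kernel_eq_cauchy\<close> reduces this to
  Cauchy's formula at \<open>z\<close> for a modified function that has the same value at
  \<open>z\<close>.\<close>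

theorem poisson_formula:
  assumes c: "continuous_on (cball 0 1) h" and hol: "h holomorphic_on ball 0 1"
    and z: "z \<in> ball 0 1"
  shows "(LINT \<xi>|circle_measure. h \<xi> * poisson_kernel z \<xi>) = h z"
proof -
  \<comment> \<open>\<open>k\<close> absorbs the factor of the kernel that is holomorphic in
    \<open>\<xi>\<close>. At \<open>\<xi> = z\<close> this factor is
    \<open>(1 - |z|^2) / (1 - |z|^2)\<close>, hence \<open>k z = h z\<close>.\<close>
  define k where "k \<xi> = h \<xi> * ((1 - (cmod z)\<^sup>2) / (1 - cnj z * \<xi>))" for \<xi>
  have z1: "cmod z < 1" using z by simp
  have nz: "1 - cnj z * \<xi> \<noteq> 0" if "cmod \<xi> \<le> 1" for \<xi>
  proof
    assume "1 - cnj z * \<xi> = 0"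
    then have "cmod (cnj z * \<xi>) = 1" by simp
    then have "cmod z * cmod \<xi> = 1" by (simp add: norm_mult)
    moreover have "cmod z * cmod \<xi> \<le> cmod z * 1"
      using that by (intro mult_left_mono) auto
    ultimately show False using z1 by simp
  qed
  have kc: "continuous_on (cball 0 1) k" unfolding k_def using nz
    by (intro continuous_intros c) auto
  have kh: "k holomorphic_on ball 0 1" unfolding k_def using nz
    by (intro holomorphic_intros hol) auto
  have "((\<lambda>u. k u / (u - z)) has_contour_integral (2 * of_real pi * \<i> * k z)) (circlepath 0 1)"
    by (rule Cauchy_integral_circlepath[OF kc kh]) (use z1 in simp)
  then have "((\<lambda>t. k (cis t) / (cis t - z) * (\<i> * cis t)) has_integral
      (2 * of_real pi * \<i> * k z)) {0..2 * pi}"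
    unfolding circlepath_def
    by (subst (asm) has_contour_integral_part_circlepath_iff) (auto simp: mult_ac)
  then have "((\<lambda>t. k (cis t) / (cis t - z) * (\<i> * cis t) / \<i>) has_integral
      (2 * of_real pi * \<i> * k z) / \<i>) {0..2 * pi}"
    by (rule has_integral_divide)
  then have 1: "integral {0..2 * pi} (\<lambda>t. k (cis t) / (cis t - z) * cis t) = 2 * of_real pi * k z"
    by (intro integral_unique) (simp add: mult_ac)
  have eq: "h \<xi> * poisson_kernel z \<xi> = k \<xi> / (\<xi> - z) * \<xi>" if "cmod \<xi> = 1" for \<xi>
    using poisson_kernel_eq_cauchy[OF that z1] by (simp add: k_def)
  have kz: "k z = h z"
  proof -
    have "cnj z * z = of_real ((cmod z)\<^sup>2)"
      unfolding complex_norm_square by (simp add: mult_ac)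
    moreover have "1 - cnj z * z \<noteq> 0" using nz[of z] z1 by simp
    ultimately show ?thesis by (simp add: k_def)
  qed
  have "continuous_on (sphere 0 1) (\<lambda>\<xi>. h \<xi> * poisson_kernel z \<xi>)"
    using z by (intro continuous_intros continuous_on_subset[OF c]) auto
  then have "(LINT \<xi>|circle_measure. h \<xi> * poisson_kernel z \<xi>)
     = integral {0..2 * pi} (\<lambda>t. h (cis t) * poisson_kernel z (cis t)) / (2 * pi)"
    by (rule integral_circle_measure)
  also have "\<dots> = k z"
    using 1 by (simp add: eq cong: integral_cong)
  finally show ?thesis by (simp add: kz)
qed

lemma circle_mean_value:
  assumes c: "continuous_on (cball 0 1) h" and hol: "h holomorphic_on ball 0 1"
  shows "(LINT \<xi>|circle_measure. h \<xi>) = h 0"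
proof -
  have "(LINT \<xi>|circle_measure. h \<xi>) = (LINT \<xi>|circle_measure. h \<xi> * poisson_kernel 0 \<xi>)"
    by (intro Bochner_Integration.integral_cong) (auto simp: poisson_kernel_def)
  then show ?thesis using poisson_formula[OF c hol, of 0] by simp
qed

lemma integral_poisson_kernel:
  assumes "z \<in> ball 0 1"
  shows "(LINT \<xi>|circle_measure. poisson_kernel z \<xi>) = 1"
proof -
  have "complex_of_real (LINT \<xi>|circle_measure. poisson_kernel z \<xi>) = 1"
    using poisson_formula[of "\<lambda>_. 1", OF _ _ assms]
    by simp
  then show ?thesis using of_real_eq_1_iff by blast
qed

lemma integrable_circle_continuous:
  fixes h :: "complex \<Rightarrow> 'a::{banach, second_countable_topology}"
  assumes "continuous_on (sphere 0 1) h"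
  shows "integrable circle_measure h"
proof -
  have "bounded (h ` sphere 0 1)"
    by (intro compact_imp_bounded compact_continuous_image assms) auto
  then obtain B where "\<forall>\<xi>\<in>sphere 0 1. norm (h \<xi>) \<le> B"
    unfolding bounded_iff by blast
  then show ?thesis
    by (intro circle.integrable_const_bound[where B = B] AE_I2 borel_measurable_circleI assms) auto
qed

section \<open>Symmetry, semigroup law and comparison of Poisson kernels\<close>

lemma measurable_poisson_kernel [measurable (raw)]:
  assumes [measurable]: "f \<in> borel_measurable M" "g \<in> borel_measurable M"
  shows "(\<lambda>x. poisson_kernel (f x) (g x)) \<in> borel_measurable M"
  unfolding poisson_kernel_def by measurable

text \<open>One difference is the conjugate of the other up to the unimodular factor
  \<open>\<eta> * \<xi>\<close>, so the denominators agree. Either variable can thus play the role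
  of the boundary point.\<close>

lemma poisson_kernel_sym:
  assumes "cmod \<xi> = 1" "cmod \<eta> = 1"
  shows "poisson_kernel (of_real s * \<xi>) \<eta> = poisson_kernel (of_real s * \<eta>) \<xi>"
proof -
  have "cmod (\<eta> - of_real s * \<xi>) = cmod (\<xi> - of_real s * \<eta>)"
  proof -
    have "\<eta> - of_real s * \<xi> = \<eta> * \<xi> * cnj (\<xi> - of_real s * \<eta>)"
      using cmod_eq_1_cnj[OF assms(1)] cmod_eq_1_cnj[OF assms(2)]
      by (simp add: algebra_simps)
    then show ?thesis
      using assms by (metis complex_mod_cnj mult_1 norm_mult)
  qed
  then show ?thesis
    using assms by (simp add: poisson_kernel_def norm_mult)
qed

text \<open>Multiplying by the conjugate of the denominator leaves \<open>1 - |v|^2\<close> plus a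
  number \<open>w - cnj w\<close>, which is purely imaginary. This exhibits the kernel as the real
  part of a function holomorphic in \<open>v\<close>.\<close>

lemma Re_herglotz_kernel:
  assumes "cmod \<xi> = 1"
  shows "Re ((\<xi> + v) / (\<xi> - v)) = poisson_kernel v \<xi>"
proof -
  have "(\<xi> + v) * cnj (\<xi> - v) = of_real (1 - (cmod v)\<^sup>2) + (v * cnj \<xi> - cnj (v * cnj \<xi>))"
    using cmod_eq_1_cnj[OF assms] complex_norm_square[of v]
    by (simp add: algebra_simps)
  moreover have "Re (w - cnj w) = 0" for w
    by simp
  ultimately have "Re ((\<xi> + v) * cnj (\<xi> - v)) = 1 - (cmod v)\<^sup>2"
    by (metis Re_complex_of_real add.right_neutral plus_complex.sel(1))
  then show ?thesis
    unfolding poisson_kernel_def complex_div_cnj[of "\<xi> + v" "\<xi> - v"]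
    by (simp flip: of_real_power)
qed

text \<open>On the circle the second kernel is the real part of a function holomorphic in
  \<open>\<eta>\<close>; integrating it against the first kernel evaluates that function at
  \<open>a * \<xi>\<close>.\<close>

lemma poisson_kernel_semigroup:
  assumes \<xi>: "cmod \<xi> = 1" and \<xi>': "cmod \<xi>' = 1" and a: "0 \<le> a" "a < 1" and b: "0 \<le> b" "b < 1"
  shows "(LINT \<eta>|circle_measure. poisson_kernel (of_real a * \<xi>) \<eta> * poisson_kernel (of_real b * \<xi>') \<eta>)
     = poisson_kernel (of_real (a * b) * \<xi>) \<xi>'"
proof -
  \<comment> \<open>For \<open>w\<close> on the circle, symmetry of the kernel makes
    \<open>Re (S w)\<close> the Poisson kernel of the point \<open>b * \<xi>'\<close>. As
    \<open>b < 1\<close>, \<open>S\<close> has no pole in the closed disc.\<close>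
  define S where "S w = (\<xi>' + of_real b * w) / (\<xi>' - of_real b * w)" for w
  have nz: "\<xi>' - of_real b * w \<noteq> 0" if "cmod w \<le> 1" for w
  proof
    assume "\<xi>' - of_real b * w = 0"
    then have "cmod \<xi>' = b * cmod w" using b by (simp add: norm_mult)
    also have "\<dots> \<le> b * 1" using that b by (intro mult_left_mono) auto
    finally show False using b \<xi>' by simp
  qed
  have Sc: "continuous_on (cball 0 1) S" and Sh: "S holomorphic_on ball 0 1"
    unfolding S_def using nz by (auto intro!: continuous_intros holomorphic_intros)
  have z: "of_real a * \<xi> \<in> ball 0 1" using a \<xi> by (simp add: norm_mult)
  have "(LINT \<eta>|circle_measure. Re (S \<eta> * poisson_kernel (of_real a * \<xi>) \<eta>))
     = Re (LINT \<eta>|circle_measure. S \<eta> * poisson_kernel (of_real a * \<xi>) \<eta>)"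
    using z
    by (intro integral_Re integrable_circle_continuous continuous_intros
        continuous_on_subset[OF Sc]) auto
  also have "\<dots> = Re (S (of_real a * \<xi>))"
    using poisson_formula[OF Sc Sh z] by simp
  also have "\<dots> = poisson_kernel (of_real (a * b) * \<xi>) \<xi>'"
    unfolding S_def Re_herglotz_kernel[OF \<xi>'] by (simp add: mult_ac)
  finally have *: "(LINT \<eta>|circle_measure. Re (S \<eta> * poisson_kernel (of_real a * \<xi>) \<eta>))
     = poisson_kernel (of_real (a * b) * \<xi>) \<xi>'" .
  have S_eq: "Re (S \<eta>) = poisson_kernel (of_real b * \<xi>') \<eta>" if "cmod \<eta> = 1" for \<eta>
    using Re_herglotz_kernel[OF \<xi>', of "of_real b * \<eta>"] poisson_kernel_sym[OF that \<xi>', of b]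
    by (simp add: S_def)
  have "(LINT \<eta>|circle_measure. poisson_kernel (of_real a * \<xi>) \<eta> * poisson_kernel (of_real b * \<xi>') \<eta>)
      = (LINT \<eta>|circle_measure. Re (S \<eta> * poisson_kernel (of_real a * \<xi>) \<eta>))"
    by (intro Bochner_Integration.integral_cong) (simp_all add: S_eq)
  then show ?thesis using * by (rule trans)
qed

lemma nn_integral_poisson_kernel_semigroup:
  assumes "cmod \<xi> = 1" "cmod \<xi>' = 1" "0 \<le> a" "a < 1" "0 \<le> b" "b < 1"
  shows "(\<integral>\<^sup>+\<eta>. ennreal (poisson_kernel (of_real a * \<xi>) \<eta>)
            * ennreal (poisson_kernel (of_real b * \<xi>') \<eta>) \<partial>circle_measure)
     = ennreal (poisson_kernel (of_real (a * b) * \<xi>) \<xi>')"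
proof -
  have z: "of_real a * \<xi> \<in> ball 0 1" "of_real b * \<xi>' \<in> ball 0 1"
    using assms by (auto simp: norm_mult)
  have "(\<integral>\<^sup>+\<eta>. ennreal (poisson_kernel (of_real a * \<xi>) \<eta>)
            * ennreal (poisson_kernel (of_real b * \<xi>') \<eta>) \<partial>circle_measure)
     = (\<integral>\<^sup>+\<eta>. ennreal (poisson_kernel (of_real a * \<xi>) \<eta> * poisson_kernel (of_real b * \<xi>') \<eta>)
           \<partial>circle_measure)"
    using z by (simp add: ennreal_mult' poisson_kernel_nonneg)
  also have "\<dots> = ennreal (LINT \<eta>|circle_measure.
       poisson_kernel (of_real a * \<xi>) \<eta> * poisson_kernel (of_real b * \<xi>') \<eta>)"
    using z by (intro nn_integral_eq_integral integrable_circle_continuous continuous_intros)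
      (auto simp: poisson_kernel_nonneg)
  finally show ?thesis using poisson_kernel_semigroup[OF assms] by simp
qed

text \<open>For \<open>a \<le> b\<close> the product \<open>s = a * b\<close> lies between
  \<open>a^2\<close> and \<open>a\<close>. Hence
  \<open>1 - s^2 \<le> 1 - a^4 \<le> 2 * (1 - a^2)\<close>, while the distance of
  \<open>\<xi>'\<close> to \<open>a * \<xi>\<close> is at most twice its distance to
  \<open>s * \<xi>\<close>. The constant is 8 = 2 * 4, the 4 coming from the squared
  distances.\<close>

lemma poisson_kernel_radius_le:
  assumes \<xi>: "cmod \<xi> = 1" and \<xi>': "cmod \<xi>' = 1" and ab: "0 \<le> a" "a \<le> b" "b < 1"
  shows "poisson_kernel (of_real (a * b) * \<xi>) \<xi>' \<le> 8 * poisson_kernel (of_real a * \<xi>) \<xi>'"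
proof -
  define s where "s = a * b"
  have s: "s \<le> a" "a\<^sup>2 \<le> s" "0 \<le> s" "s < 1"
    using ab by (auto simp: s_def power2_eq_square mult_left_mono mult_left_le)
       (metis le_less_trans mult_left_le less_imp_le mult.commute order_less_le_trans)
  have low: "1 - s \<le> cmod (\<xi>' - of_real s * \<xi>)"
    using norm_triangle_ineq2[of \<xi>' "of_real s * \<xi>"] \<xi> \<xi>' s by (simp add: norm_mult)
  have "cmod (\<xi>' - of_real a * \<xi>) \<le> cmod (\<xi>' - of_real s * \<xi>) + cmod (of_real (a - s) * \<xi>)"
    using norm_triangle_ineq4[of "\<xi>' - of_real s * \<xi>" "of_real (a - s) * \<xi>"]
    by (simp add: algebra_simps)
  also have "cmod (of_real (a - s) * \<xi>) = a - s"
    using s \<xi> by (simp add: norm_mult del: of_real_diff)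
  finally have "cmod (\<xi>' - of_real a * \<xi>) \<le> 2 * cmod (\<xi>' - of_real s * \<xi>)"
    using low s ab by simp
  then have D: "(cmod (\<xi>' - of_real a * \<xi>))\<^sup>2 \<le> 4 * (cmod (\<xi>' - of_real s * \<xi>))\<^sup>2"
    using power_mono[of "cmod (\<xi>' - of_real a * \<xi>)" "2 * cmod (\<xi>' - of_real s * \<xi>)" 2]
    by (simp add: power_mult_distrib)
  have "(a\<^sup>2)\<^sup>2 \<le> s\<^sup>2" using s by (intro power_mono) auto
  moreover have "a\<^sup>2 \<le> 1" using ab by (simp add: power_le_one)
  moreover have "2 * (1 - a\<^sup>2) - (1 - (a\<^sup>2)\<^sup>2) = (1 - a\<^sup>2)\<^sup>2"
    by (simp add: power2_eq_square algebra_simps)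
  ultimately have num: "1 - s\<^sup>2 \<le> 2 * (1 - a\<^sup>2)"
    using zero_le_power2[of "1 - a\<^sup>2"] by linarith
  have pos: "cmod (\<xi>' - of_real a * \<xi>) > 0" "cmod (\<xi>' - of_real s * \<xi>) > 0"
  proof -
    show "cmod (\<xi>' - of_real s * \<xi>) > 0" using low s by linarith
    have "1 - a \<le> cmod (\<xi>' - of_real a * \<xi>)"
      using norm_triangle_ineq2[of \<xi>' "of_real a * \<xi>"] \<xi> \<xi>' ab by (simp add: norm_mult)
    then show "cmod (\<xi>' - of_real a * \<xi>) > 0" using ab by linarith
  qed
  have frac: "n / E \<le> 8 * (m / D)" if "n * D \<le> (2 * m) * (4 * E)" "D > 0" "E > 0" for n m D E :: real
    using that by (simp add: field_simps)
  have "(1 - s\<^sup>2) * (cmod (\<xi>' - of_real a * \<xi>))\<^sup>2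
      \<le> (2 * (1 - a\<^sup>2)) * (4 * (cmod (\<xi>' - of_real s * \<xi>))\<^sup>2)"
    using D num \<open>a\<^sup>2 \<le> 1\<close> by (intro mult_mono) auto
  then have "(1 - s\<^sup>2) / (cmod (\<xi>' - of_real s * \<xi>))\<^sup>2
      \<le> 8 * ((1 - a\<^sup>2) / (cmod (\<xi>' - of_real a * \<xi>))\<^sup>2)"
    using pos by (intro frac) auto
  then show ?thesis
    using \<xi> s ab unfolding s_def[symmetric] by (simp add: poisson_kernel_def norm_mult)
qed

text \<open>The kernel with the smaller radius dominates. Which radius is smaller varies with the
  pair of points, so the sum of both kernels is taken; symmetry turns one case into the
  other.\<close>

lemma poisson_kernel_mult_radius_le:
  assumes "cmod \<xi> = 1" "cmod \<xi>' = 1" "0 \<le> a" "a < 1" "0 \<le> b" "b < 1"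
  shows "poisson_kernel (of_real (a * b) * \<xi>) \<xi>'
     \<le> 8 * (poisson_kernel (of_real a * \<xi>) \<xi>' + poisson_kernel (of_real b * \<xi>') \<xi>)"
proof -
  have nn: "0 \<le> poisson_kernel (of_real a * \<xi>) \<xi>'" "0 \<le> poisson_kernel (of_real b * \<xi>') \<xi>"
    using assms by (auto intro!: poisson_kernel_nonneg simp: norm_mult)
  consider "a \<le> b" | "b \<le> a" by linarith
  then show ?thesis
  proof cases
    case 1
    then show ?thesis using poisson_kernel_radius_le[of \<xi> \<xi>' a b] assms nn by simp
  next
    case 2
    have "poisson_kernel (of_real (a * b) * \<xi>) \<xi>' = poisson_kernel (of_real (b * a) * \<xi>') \<xi>"
      using poisson_kernel_sym[OF assms(1,2), of "a * b"] by (simp only: mult.commute)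
    then show ?thesis using poisson_kernel_radius_le[of \<xi>' \<xi> b a] assms nn 2 by simp
  qed
qed

lemma poisson_kernel_le:
  assumes "cmod \<xi> = 1" "cmod \<eta> = 1" "0 \<le> a" "a \<le> \<sigma>" "\<sigma> < 1"
  shows "poisson_kernel (of_real a * \<xi>) \<eta> \<le> 1 / (1 - \<sigma>)\<^sup>2"
proof -
  have "1 - \<sigma> \<le> 1 - a" using assms by simp
  also have "1 - a \<le> cmod (\<eta> - of_real a * \<xi>)"
    using norm_triangle_ineq2[of \<eta> "of_real a * \<xi>"] assms by (simp add: norm_mult)
  finally have "(1 - \<sigma>)\<^sup>2 \<le> (cmod (\<eta> - of_real a * \<xi>))\<^sup>2"
    using assms by (intro power_mono) auto
  then show ?thesis
    using assms unfolding poisson_kernel_def by (intro frac_le) (auto simp: norm_mult)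
qed

section \<open>The radial maximal inequality and radial limits\<close>

text \<open>This is the \<open>T T\<^sup>*\<close> method for the linearised radial maximal operator: by the semigroup law the
  kernel of \<open>T T\<^sup>*\<close> is a Poisson kernel at the product of the radii, which is dominated by the kernels
  of \<open>T\<close> and \<open>T\<^sup>*\<close>. So the norm of \<open>T\<^sup>*\<close> squared is at most 16 times the norm itself; the bound
  \<open>\<sigma>\<close> on the radii only serves to make that norm finite beforehand.\<close>

lemma nn_integral_poisson_adjoint_square:
  fixes r :: "complex \<Rightarrow> real"
  assumes r_meas [measurable]: "r \<in> borel_measurable circle_measure"
    and r: "\<And>\<xi>. 0 \<le> r \<xi>" "\<And>\<xi>. r \<xi> \<le> \<sigma>" "\<sigma> < 1"
    and E [measurable]: "E \<in> sets circle_measure"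
  shows "(\<integral>\<^sup>+\<eta>. (\<integral>\<^sup>+\<xi>. indicator E \<xi> * ennreal (poisson_kernel (of_real (r \<xi>) * \<xi>) \<eta>) \<partial>circle_measure)\<^sup>2
           \<partial>circle_measure) \<le> 256 * emeasure circle_measure E"
proof -
  let ?M = circle_measure
  define K where "K \<xi> \<eta> = ennreal (poisson_kernel (of_real (r \<xi>) * \<xi>) \<eta>)" for \<xi> \<eta>
  define \<psi> :: "complex \<Rightarrow> ennreal" where "\<psi> = indicator E"
  define A where "A \<eta> = (\<integral>\<^sup>+\<xi>. \<psi> \<xi> * K \<xi> \<eta> \<partial>?M)" for \<eta>
  define I where "I = (\<integral>\<^sup>+\<eta>. (A \<eta>)\<^sup>2 \<partial>?M)"
  interpret pair_sigma_finite ?M ?M ..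
  have r1: "r \<xi> < 1" for \<xi> using r(2)[of \<xi>] r(3) by linarith
  have [measurable]: "case_prod K \<in> borel_measurable (?M \<Otimes>\<^sub>M ?M)"
    unfolding K_def by measurable
  have [measurable]: "K \<xi> \<in> borel_measurable ?M" for \<xi>
    unfolding K_def by measurable
  have [measurable]: "(\<lambda>\<xi>. K \<xi> \<eta>) \<in> borel_measurable ?M" for \<eta>
    unfolding K_def by measurable
  have [measurable]: "\<psi> \<in> borel_measurable ?M"
    unfolding \<psi>_def by measurable
  have [measurable]: "A \<in> borel_measurable ?M"
    unfolding A_def by measurable
  \<comment> \<open>After Tonelli the inner integral is a Poisson kernel at the product of the two
    radii. The comparison lemma splits it into a kernel with radius \<open>r \<xi>\<close> and one
    with radius \<open>r \<xi>'\<close>.\<close>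
  have KA: "(\<integral>\<^sup>+\<eta>. K \<xi> \<eta> * A \<eta> \<partial>?M) \<le> 8 * (\<integral>\<^sup>+\<xi>'. \<psi> \<xi>' * K \<xi> \<xi>' \<partial>?M) + 8 * A \<xi>"
    if \<xi>: "\<xi> \<in> space ?M" for \<xi>
  proof -
    have "(\<integral>\<^sup>+\<eta>. K \<xi> \<eta> * A \<eta> \<partial>?M) = (\<integral>\<^sup>+\<eta>. \<integral>\<^sup>+\<xi>'. \<psi> \<xi>' * (K \<xi> \<eta> * K \<xi>' \<eta>) \<partial>?M \<partial>?M)"
      unfolding A_def by (subst nn_integral_cmult[symmetric]) (auto simp: mult_ac)
    also have "\<dots> = (\<integral>\<^sup>+\<xi>'. \<integral>\<^sup>+\<eta>. \<psi> \<xi>' * (K \<xi> \<eta> * K \<xi>' \<eta>) \<partial>?M \<partial>?M)"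
      by (rule Fubini') measurable
    also have "\<dots> = (\<integral>\<^sup>+\<xi>'. \<psi> \<xi>' * (\<integral>\<^sup>+\<eta>. K \<xi> \<eta> * K \<xi>' \<eta> \<partial>?M) \<partial>?M)"
      by (subst nn_integral_cmult) auto
    also have "\<dots> \<le> (\<integral>\<^sup>+\<xi>'. 8 * (\<psi> \<xi>' * K \<xi> \<xi>') + 8 * (\<psi> \<xi>' * K \<xi>' \<xi>) \<partial>?M)"
    proof (rule nn_integral_mono)
      fix \<xi>' assume \<xi>': "\<xi>' \<in> space ?M"
      have nn: "0 \<le> poisson_kernel (of_real (r \<xi>) * \<xi>) \<xi>'" "0 \<le> poisson_kernel (of_real (r \<xi>') * \<xi>') \<xi>"
        using r(1) r1 \<xi> \<xi>' by (auto intro!: poisson_kernel_nonneg simp: norm_mult)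
      have "(\<integral>\<^sup>+\<eta>. K \<xi> \<eta> * K \<xi>' \<eta> \<partial>?M) = ennreal (poisson_kernel (of_real (r \<xi> * r \<xi>') * \<xi>) \<xi>')"
        unfolding K_def using \<xi> \<xi>' r r1 by (intro nn_integral_poisson_kernel_semigroup) auto
      also have "\<dots> \<le> ennreal (8 * (poisson_kernel (of_real (r \<xi>) * \<xi>) \<xi>' + poisson_kernel (of_real (r \<xi>') * \<xi>') \<xi>))"
        using \<xi> \<xi>' r r1 by (intro ennreal_leI poisson_kernel_mult_radius_le) auto
      also have "\<dots> = 8 * K \<xi> \<xi>' + 8 * K \<xi>' \<xi>"
        unfolding K_def using nn by (simp add: ennreal_mult' distrib_left)
      finally have "\<psi> \<xi>' * (\<integral>\<^sup>+\<eta>. K \<xi> \<eta> * K \<xi>' \<eta> \<partial>?M) \<le> \<psi> \<xi>' * (8 * K \<xi> \<xi>' + 8 * K \<xi>' \<xi>)"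
        by (intro mult_left_mono) auto
      then show "\<psi> \<xi>' * (\<integral>\<^sup>+\<eta>. K \<xi> \<eta> * K \<xi>' \<eta> \<partial>?M) \<le> 8 * (\<psi> \<xi>' * K \<xi> \<xi>') + 8 * (\<psi> \<xi>' * K \<xi>' \<xi>)"
        by (simp add: distrib_left mult_ac)
    qed
    also have "\<dots> = 8 * (\<integral>\<^sup>+\<xi>'. \<psi> \<xi>' * K \<xi> \<xi>' \<partial>?M) + 8 * A \<xi>"
      unfolding A_def by (simp add: nn_integral_add nn_integral_cmult)
    finally show ?thesis .
  qed
  have "I = (\<integral>\<^sup>+\<eta>. \<integral>\<^sup>+\<xi>. \<psi> \<xi> * (K \<xi> \<eta> * A \<eta>) \<partial>?M \<partial>?M)"
  proof -
    have "(\<integral>\<^sup>+\<xi>. \<psi> \<xi> * (K \<xi> \<eta> * A \<eta>) \<partial>?M) = (A \<eta>)\<^sup>2" for \<eta>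
      using nn_integral_multc[of "\<lambda>\<xi>. \<psi> \<xi> * K \<xi> \<eta>" ?M "A \<eta>"]
      by (simp add: A_def[symmetric] power2_eq_square mult.assoc)
    then show ?thesis by (simp add: I_def)
  qed
  also have "\<dots> = (\<integral>\<^sup>+\<xi>. \<integral>\<^sup>+\<eta>. \<psi> \<xi> * (K \<xi> \<eta> * A \<eta>) \<partial>?M \<partial>?M)"
    by (rule Fubini') measurable
  also have "\<dots> = (\<integral>\<^sup>+\<xi>. \<psi> \<xi> * (\<integral>\<^sup>+\<eta>. K \<xi> \<eta> * A \<eta> \<partial>?M) \<partial>?M)"
    by (subst nn_integral_cmult) auto
  also have "\<dots> \<le> (\<integral>\<^sup>+\<xi>. \<psi> \<xi> * (8 * (\<integral>\<^sup>+\<xi>'. \<psi> \<xi>' * K \<xi> \<xi>' \<partial>?M) + 8 * A \<xi>) \<partial>?M)"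
    by (intro nn_integral_mono mult_left_mono KA) auto
  also have "\<dots> = (\<integral>\<^sup>+\<xi>. 8 * (\<psi> \<xi> * (\<integral>\<^sup>+\<xi>'. \<psi> \<xi>' * K \<xi> \<xi>' \<partial>?M)) + 8 * (\<psi> \<xi> * A \<xi>) \<partial>?M)"
    by (simp add: distrib_left mult_ac)
  also have "\<dots> = 8 * (\<integral>\<^sup>+\<xi>. \<psi> \<xi> * (\<integral>\<^sup>+\<xi>'. \<psi> \<xi>' * K \<xi> \<xi>' \<partial>?M) \<partial>?M) + 8 * (\<integral>\<^sup>+\<xi>. \<psi> \<xi> * A \<xi> \<partial>?M)"
    by (simp add: nn_integral_add nn_integral_cmult)
  \<comment> \<open>Tonelli identifies the first of the two terms with the second, so 8 + 8 gives
    the factor 16.\<close>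
  also have "(\<integral>\<^sup>+\<xi>. \<psi> \<xi> * (\<integral>\<^sup>+\<xi>'. \<psi> \<xi>' * K \<xi> \<xi>' \<partial>?M) \<partial>?M)
      = (\<integral>\<^sup>+\<xi>. \<integral>\<^sup>+\<xi>'. \<psi> \<xi>' * (\<psi> \<xi> * K \<xi> \<xi>') \<partial>?M \<partial>?M)"
    by (subst nn_integral_cmult[symmetric]) (auto simp: mult_ac)
  also have "\<dots> = (\<integral>\<^sup>+\<xi>'. \<integral>\<^sup>+\<xi>. \<psi> \<xi>' * (\<psi> \<xi> * K \<xi> \<xi>') \<partial>?M \<partial>?M)"
    by (rule Fubini') measurable
  also have "\<dots> = (\<integral>\<^sup>+\<xi>. \<psi> \<xi> * A \<xi> \<partial>?M)"
    unfolding A_def by (subst nn_integral_cmult) auto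
  finally have I_le: "I \<le> 16 * (\<integral>\<^sup>+\<xi>. \<psi> \<xi> * A \<xi> \<partial>?M)"
    by (simp flip: distrib_right)
  \<comment> \<open>Squaring before Cauchy-Schwarz brings \<open>I\<close> itself back on the right.
    Since \<open>\<psi>\<close> is an indicator, the other factor is the measure of
    \<open>E\<close>, and 256 is the square of 16.\<close>
  have "I * I \<le> (16 * (\<integral>\<^sup>+\<xi>. \<psi> \<xi> * A \<xi> \<partial>?M)) * (16 * (\<integral>\<^sup>+\<xi>. \<psi> \<xi> * A \<xi> \<partial>?M))"
    by (intro mult_mono I_le) auto
  also have "\<dots> = 256 * (\<integral>\<^sup>+\<xi>. \<psi> \<xi> * A \<xi> \<partial>?M)\<^sup>2"
    by (simp add: power2_eq_square mult_ac)
  also have "\<dots> \<le> 256 * ((\<integral>\<^sup>+\<xi>. (\<psi> \<xi>)\<^sup>2 \<partial>?M) * I)"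
    unfolding I_def by (intro mult_left_mono Cauchy_Schwarz_nn_integral) auto
  also have "(\<integral>\<^sup>+\<xi>. (\<psi> \<xi>)\<^sup>2 \<partial>?M) = (\<integral>\<^sup>+\<xi>. indicator E \<xi> \<partial>?M)"
    by (intro nn_integral_cong) (auto simp: \<psi>_def split: split_indicator)
  also have "\<dots> = emeasure ?M E"
    by simp
  finally have I2: "I * I \<le> I * (256 * emeasure ?M E)"
    by (simp add: mult_ac)
  \<comment> \<open>Cancelling one factor \<open>I\<close> requires finiteness. The uniform bound
    \<open>\<sigma>\<close> on the radii bounds the kernel and hence \<open>A\<close>.\<close>
  have "I \<noteq> \<top>"
  proof -
    define B where "B = ennreal (1 / (1 - \<sigma>)\<^sup>2)"
    have "A \<eta> \<le> B" if "\<eta> \<in> space ?M" for \<eta>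
    proof -
      have "A \<eta> \<le> (\<integral>\<^sup>+\<xi>. B \<partial>?M)"
        unfolding A_def
      proof (rule nn_integral_mono)
        fix \<xi> assume "\<xi> \<in> space ?M"
        then have "K \<xi> \<eta> \<le> B"
          unfolding K_def B_def using r that by (intro ennreal_leI poisson_kernel_le) auto
        then show "\<psi> \<xi> * K \<xi> \<eta> \<le> B"
          by (auto simp: \<psi>_def split: split_indicator)
      qed
      then show ?thesis by (simp add: circle.emeasure_space_1 del: space_circle_measure)
    qed
    then have "I \<le> (\<integral>\<^sup>+\<eta>. B\<^sup>2 \<partial>?M)"
      unfolding I_def by (intro nn_integral_mono power_mono) auto
    also have "\<dots> = B\<^sup>2" by (simp add: circle.emeasure_space_1 del: space_circle_measure)
    also have "\<dots> < \<top>" by (simp add: B_def power_less_top_ennreal)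
    finally show ?thesis by simp
  qed
  then have "I \<le> 256 * emeasure ?M E"
    using I2 ennreal_mult_le_mult_iff[of I I "256 * emeasure ?M E"] by (cases "I = 0") auto
  then show ?thesis
    unfolding I_def A_def \<psi>_def K_def .
qed

section \<open>Dilates of holomorphic functions and the weak-type inequality for their radial
  supremum\<close>

lemma of_real_mult_circle_in_ball:
  assumes "0 \<le> s" "s < 1" "cmod \<xi> = 1"
  shows "of_real s * \<xi> \<in> ball 0 1"
  using assms by (simp add: norm_mult)

lemma continuous_on_dilate:
  fixes h :: "complex \<Rightarrow> 'a::topological_space"
  assumes "continuous_on (ball 0 1) h" "0 \<le> s" "s < 1"
  shows "continuous_on (cball 0 1) (\<lambda>\<xi>. h (of_real s * \<xi>))"
proof (rule continuous_on_compose2[OF assms(1)])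
  show "(\<lambda>\<xi>::complex. of_real s * \<xi>) ` cball 0 1 \<subseteq> ball 0 1"
  proof
    fix y assume "y \<in> (\<lambda>\<xi>. complex_of_real s * \<xi>) ` cball 0 1"
    then obtain \<xi> where \<xi>: "cmod \<xi> \<le> 1" "y = of_real s * \<xi>" by auto
    have "cmod y = s * cmod \<xi>" using \<xi> assms by (simp add: norm_mult)
    also have "\<dots> \<le> s * 1" using \<xi> assms by (intro mult_left_mono) auto
    finally show "y \<in> ball 0 1" using assms by simp
  qed
qed (intro continuous_intros)

lemma holomorphic_on_dilate:
  assumes "h holomorphic_on ball 0 1" "0 \<le> s" "s \<le> 1"
  shows "(\<lambda>\<xi>. h (of_real s * \<xi>)) holomorphic_on ball 0 1"
proof -
  have "of_real s * \<xi> \<in> ball 0 1" if "\<xi> \<in> ball 0 1" for \<xi> :: complex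
  proof -
    have "s * cmod \<xi> \<le> 1 * cmod \<xi>" using assms by (intro mult_right_mono) auto
    then show ?thesis using that assms by (simp add: norm_mult)
  qed
  then have "(h \<circ> (\<lambda>\<xi>. of_real s * \<xi>)) holomorphic_on ball 0 1"
    by (intro holomorphic_on_compose_gen[OF _ assms(1)] holomorphic_intros) auto
  then show ?thesis by (simp add: o_def)
qed

lemma measurable_dilate:
  fixes h :: "complex \<Rightarrow> 'a::topological_space"
  assumes "continuous_on (ball 0 1) h" "0 \<le> s" "s < 1"
  shows "(\<lambda>\<xi>. h (of_real s * \<xi>)) \<in> borel_measurable circle_measure"
  by (intro borel_measurable_circleI continuous_on_subset[OF continuous_on_dilate[OF assms]]) auto

text \<open>With finitely many radii, each point of the exceptional set can be assigned measurably
  one radius at which \<open>h\<close> is large. Integrating the resulting Poisson integral over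
  that set and passing to the adjoint reduces the claim to
  \<open>nn_integral_poisson_adjoint_square\<close>.\<close>

lemma radial_maximal_inequality_finite:
  fixes h :: "complex \<Rightarrow> complex" and T :: ennreal and rs :: "nat \<Rightarrow> real"
  assumes hol: "h holomorphic_on ball 0 1"
    and T: "\<And>s. 0 \<le> s \<Longrightarrow> s < 1 \<Longrightarrow> (\<integral>\<^sup>+\<xi>. ennreal ((cmod (h (of_real s * \<xi>)))\<^sup>2) \<partial>circle_measure) \<le> T"
    and rs: "\<And>i. 0 \<le> rs i" "\<And>i. rs i < 1" and l: "l > 0"
  shows "ennreal (l\<^sup>2) * emeasure circle_measure
      {\<xi> \<in> space circle_measure. \<exists>i<k. cmod (h (of_real (rs i) * \<xi>)) > l} \<le> 256 * T"
proof -
  let ?M = circle_measure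
  interpret pair_sigma_finite ?M ?M ..
  define E where "E = {\<xi> \<in> space ?M. \<exists>i<k. cmod (h (of_real (rs i) * \<xi>)) > l}"
  \<comment> \<open>\<open>\<rho>0\<close> bounds all the radii and \<open>\<rho>\<close> lies
    strictly between \<open>\<rho>0\<close> and 1. The dilate by \<open>\<rho>\<close> is then
    continuous up to the circle, and the rescaled radii stay below
    \<open>\<sigma> = \<rho>0 / \<rho> < 1\<close>. The entry 1/2 keeps the maximum defined and
    positive even for \<open>k = 0\<close>.\<close>
  define \<rho>0 where "\<rho>0 = Max (insert (1/2) (rs ` {..<k}))"
  define \<rho> where "\<rho> = (1 + \<rho>0) / 2"
  have "1/2 \<le> \<rho>0"
    unfolding \<rho>0_def by (rule Max_ge) auto
  moreover have "\<rho>0 < 1" "\<And>i. i < k \<Longrightarrow> rs i \<le> \<rho>0"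
    using rs by (auto simp: \<rho>0_def)
  ultimately have \<rho>0: "1/2 \<le> \<rho>0" "\<rho>0 < 1" "\<And>i. i < k \<Longrightarrow> rs i \<le> \<rho>0"
    by auto
  have \<rho>: "\<rho>0 < \<rho>" "0 < \<rho>" "\<rho> < 1" using \<rho>0(1,2) by (auto simp: \<rho>_def)
  define \<sigma> where "\<sigma> = \<rho>0 / \<rho>"
  have \<sigma>: "0 \<le> \<sigma>" "\<sigma> < 1" using \<rho>0 \<rho> by (auto simp: \<sigma>_def)
  have hc: "continuous_on (ball 0 1) h" by (rule holomorphic_on_imp_continuous_on[OF hol])
  have [measurable]: "(\<lambda>\<xi>. h (of_real (rs i) * \<xi>)) \<in> borel_measurable ?M" for i
    by (rule measurable_dilate[OF hc rs])
  have [measurable]: "E \<in> sets ?M"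
    unfolding E_def by measurable
  \<comment> \<open>Choosing the least admissible index makes the selected radius a measurable
    function of the point.\<close>
  define ix where "ix \<xi> = (LEAST i. i < k \<and> cmod (h (of_real (rs i) * \<xi>)) > l)" for \<xi>
  have [measurable]: "ix \<in> ?M \<rightarrow>\<^sub>M count_space UNIV"
    unfolding ix_def by measurable
  define r where "r \<xi> = (if \<xi> \<in> E then rs (ix \<xi>) / \<rho> else 0)" for \<xi>
  have ix: "ix \<xi> < k" "cmod (h (of_real (rs (ix \<xi>)) * \<xi>)) > l" if "\<xi> \<in> E" for \<xi>
  proof -
    have "\<exists>i. i < k \<and> cmod (h (of_real (rs i) * \<xi>)) > l" using that by (auto simp: E_def)
    from LeastI_ex[OF this] show "ix \<xi> < k" "cmod (h (of_real (rs (ix \<xi>)) * \<xi>)) > l"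
      by (auto simp: ix_def)
  qed
  have [measurable]: "r \<in> borel_measurable ?M"
    unfolding r_def by measurable
  have r: "0 \<le> r \<xi>" "r \<xi> \<le> \<sigma>" for \<xi>
    using rs(1) \<rho> \<sigma> ix \<rho>0 by (auto simp: r_def \<sigma>_def intro!: divide_right_mono)
  define K where "K \<xi> \<eta> = ennreal (poisson_kernel (of_real (r \<xi>) * \<xi>) \<eta>)" for \<xi> \<eta>
  define u where "u = (\<lambda>w. h (of_real \<rho> * w))"
  define \<psi> :: "complex \<Rightarrow> ennreal" where "\<psi> = indicator E"
  define A where "A \<eta> = (\<integral>\<^sup>+\<xi>. \<psi> \<xi> * K \<xi> \<eta> \<partial>?M)" for \<eta>
  have [measurable]: "case_prod K \<in> borel_measurable (?M \<Otimes>\<^sub>M ?M)"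
    unfolding K_def by measurable
  have [measurable]: "K \<xi> \<in> borel_measurable ?M" for \<xi>
    unfolding K_def by measurable
  have [measurable]: "(\<lambda>\<xi>. K \<xi> \<eta>) \<in> borel_measurable ?M" for \<eta>
    unfolding K_def by measurable
  have [measurable]: "\<psi> \<in> borel_measurable ?M"
    unfolding \<psi>_def by measurable
  have [measurable]: "A \<in> borel_measurable ?M"
    unfolding A_def by measurable
  have [measurable]: "u \<in> borel_measurable ?M"
    unfolding u_def using \<rho> by (intro measurable_dilate[OF hc]) auto
  have uc: "continuous_on (cball 0 1) u" and uh: "u holomorphic_on ball 0 1"
    using continuous_on_dilate[OF hc] holomorphic_on_dilate[OF hol] \<rho> by (auto simp: u_def)
  have low: "ennreal l \<le> (\<integral>\<^sup>+\<eta>. ennreal (cmod (u \<eta>)) * K \<xi> \<eta> \<partial>?M)" if "\<xi> \<in> E" for \<xi>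
  proof -
    have z: "of_real (r \<xi>) * \<xi> \<in> ball 0 1"
      using that r[of \<xi>] \<sigma> by (intro of_real_mult_circle_in_ball) (auto simp: E_def)
    have c: "continuous_on (sphere 0 1) (\<lambda>\<eta>. u \<eta> * poisson_kernel (of_real (r \<xi>) * \<xi>) \<eta>)"
      using z by (intro continuous_intros continuous_on_subset[OF uc]) auto
    have "l \<le> cmod (u (of_real (r \<xi>) * \<xi>))"
      using ix[OF that] that \<rho> by (simp add: u_def r_def)
    also have "u (of_real (r \<xi>) * \<xi>) = (LINT \<eta>|?M. u \<eta> * poisson_kernel (of_real (r \<xi>) * \<xi>) \<eta>)"
      using poisson_formula[OF uc uh z] by simp
    finally have "ennreal l \<le> ennreal (cmod \<dots>)" by (rule ennreal_leI)
    also have "\<dots> \<le> (\<integral>\<^sup>+\<eta>. ennreal (cmod (u \<eta> * poisson_kernel (of_real (r \<xi>) * \<xi>) \<eta>)) \<partial>?M)"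
      by (intro integral_norm_bound_ennreal integrable_circle_continuous c)
    also have "\<dots> = (\<integral>\<^sup>+\<eta>. ennreal (cmod (u \<eta>)) * K \<xi> \<eta> \<partial>?M)"
      using poisson_kernel_nonneg[OF z] by (simp add: K_def norm_mult ennreal_mult')
    finally show ?thesis .
  qed
  define m where "m = emeasure ?M E"
  \<comment> \<open>A Chebyshev bound, Tonelli and Cauchy-Schwarz give
    \<open>(l * m)^2 \<le> T * 256 * m\<close>; one factor \<open>m\<close> cancels because it is
    finite.\<close>
  have "ennreal l * m = (\<integral>\<^sup>+\<xi>. \<psi> \<xi> * ennreal l \<partial>?M)"
    unfolding m_def \<psi>_def by (subst nn_integral_multc) (auto simp: mult.commute)
  also have "\<dots> \<le> (\<integral>\<^sup>+\<xi>. \<psi> \<xi> * (\<integral>\<^sup>+\<eta>. ennreal (cmod (u \<eta>)) * K \<xi> \<eta> \<partial>?M) \<partial>?M)"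
    by (intro nn_integral_mono) (auto simp: \<psi>_def low split: split_indicator)
  also have "\<dots> = (\<integral>\<^sup>+\<xi>. \<integral>\<^sup>+\<eta>. ennreal (cmod (u \<eta>)) * (\<psi> \<xi> * K \<xi> \<eta>) \<partial>?M \<partial>?M)"
    by (subst nn_integral_cmult[symmetric]) (auto simp: mult_ac)
  also have "\<dots> = (\<integral>\<^sup>+\<eta>. \<integral>\<^sup>+\<xi>. ennreal (cmod (u \<eta>)) * (\<psi> \<xi> * K \<xi> \<eta>) \<partial>?M \<partial>?M)"
    by (rule Fubini'[symmetric]) measurable
  also have "\<dots> = (\<integral>\<^sup>+\<eta>. ennreal (cmod (u \<eta>)) * A \<eta> \<partial>?M)"
    unfolding A_def by (subst nn_integral_cmult) auto
  finally have "(ennreal l * m)\<^sup>2 \<le> (\<integral>\<^sup>+\<eta>. ennreal (cmod (u \<eta>)) * A \<eta> \<partial>?M)\<^sup>2"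
    by (rule power_mono_ennreal)
  also have "\<dots> \<le> (\<integral>\<^sup>+\<eta>. (ennreal (cmod (u \<eta>)))\<^sup>2 \<partial>?M) * (\<integral>\<^sup>+\<eta>. (A \<eta>)\<^sup>2 \<partial>?M)"
    by (rule Cauchy_Schwarz_nn_integral) measurable
  also have "\<dots> \<le> T * (256 * m)"
  proof (intro mult_mono)
    show "(\<integral>\<^sup>+\<eta>. (ennreal (cmod (u \<eta>)))\<^sup>2 \<partial>?M) \<le> T"
      using T[of \<rho>] \<rho> by (simp add: u_def ennreal_power)
    show "(\<integral>\<^sup>+\<eta>. (A \<eta>)\<^sup>2 \<partial>?M) \<le> 256 * m"
      unfolding A_def \<psi>_def K_def m_def
      using r \<sigma> by (intro nn_integral_poisson_adjoint_square) auto
  qed auto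
  finally have "m * (ennreal (l\<^sup>2) * m) \<le> m * (256 * T)"
    using l by (simp add: power2_eq_square ennreal_mult mult_ac)
  moreover have "m \<noteq> \<top>" by (simp add: m_def)
  ultimately have "ennreal (l\<^sup>2) * m \<le> 256 * T"
    using ennreal_mult_le_mult_iff[of m "ennreal (l\<^sup>2) * m" "256 * T"] by (cases "m = 0") auto
  then show ?thesis unfolding m_def E_def .
qed

text \<open>The finite bound does not depend on the number of radii, so it passes to an enumeration
  of the rational radii by monotone convergence. Continuity along each radius then extends the
  conclusion to all radii.\<close>

lemma radial_maximal_inequality:
  fixes h :: "complex \<Rightarrow> complex" and T :: ennreal
  assumes hol: "h holomorphic_on ball 0 1"
    and T: "\<And>s. 0 \<le> s \<Longrightarrow> s < 1 \<Longrightarrow> (\<integral>\<^sup>+\<xi>. ennreal ((cmod (h (of_real s * \<xi>)))\<^sup>2) \<partial>circle_measure) \<le> T"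
    and l: "l > 0"
  obtains E where "E \<in> sets circle_measure" "ennreal (l\<^sup>2) * emeasure circle_measure E \<le> 256 * T"
    "\<And>\<xi> s. \<xi> \<in> space circle_measure - E \<Longrightarrow> 0 \<le> s \<Longrightarrow> s < 1 \<Longrightarrow> cmod (h (of_real s * \<xi>)) \<le> l"
proof -
  let ?M = circle_measure
  define R :: "real set" where "R = \<rat> \<inter> {0..<1}"
  have "countable R" "0 \<in> R" unfolding R_def by (auto simp: countable_rat)
  then obtain rs :: "nat \<Rightarrow> real" where rs: "range rs = R"
    by (metis empty_iff uncountable_def)
  have rs01: "0 \<le> rs i" "rs i < 1" for i
    using rs unfolding R_def by (metis IntD2 atLeastLessThan_iff rangeI)+
  define F where "F k = {\<xi> \<in> space ?M. \<exists>i<k. cmod (h (of_real (rs i) * \<xi>)) > l}" for k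
  have hc: "continuous_on (ball 0 1) h" by (rule holomorphic_on_imp_continuous_on[OF hol])
  have [measurable]: "(\<lambda>\<xi>. h (of_real (rs i) * \<xi>)) \<in> borel_measurable ?M" for i
    by (rule measurable_dilate[OF hc rs01])
  have F [measurable]: "F k \<in> sets ?M" for k
    unfolding F_def by measurable
  have inc: "incseq F"
    by (rule incseq_SucI) (auto simp: F_def intro: less_SucI)
  show ?thesis
  proof
    show "(\<Union>k. F k) \<in> sets ?M" by measurable
    have "ennreal (l\<^sup>2) * emeasure ?M (\<Union>k. F k) = (SUP k. ennreal (l\<^sup>2) * emeasure ?M (F k))"
    proof -
      have "(SUP k. emeasure ?M (F k)) = emeasure ?M (\<Union>k. F k)"
        using F by (intro SUP_emeasure_incseq inc) auto
      then show ?thesis by (simp flip: SUP_mult_left_ennreal)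
    qed
    also have "\<dots> \<le> 256 * T"
      unfolding F_def by (intro SUP_least radial_maximal_inequality_finite[OF hol T rs01 l])
    finally show "ennreal (l\<^sup>2) * emeasure ?M (\<Union>k. F k) \<le> 256 * T" .
    fix \<xi> s assume \<xi>: "\<xi> \<in> space ?M - (\<Union>k. F k)" and s: "0 \<le> s" "s < (1::real)"
    have rat: "cmod (h (of_real q * \<xi>)) \<le> l" if q: "q \<in> R" for q
    proof -
      obtain i where "rs i = q" using rs q by blast
      moreover have "\<xi> \<notin> F (Suc i)" using \<xi> by blast
      then have "\<not> cmod (h (of_real (rs i) * \<xi>)) > l" using \<xi> unfolding F_def by blast
      ultimately show ?thesis by simp
    qed
    show "cmod (h (of_real s * \<xi>)) \<le> l"
    proof (rule ccontr)
      assume "\<not> ?thesis"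
      \<comment> \<open>The inequality is strict, hence it persists at nearby radii, among which
        there is a rational one to the right of \<open>s\<close> and below 1.\<close>
      then have gt: "cmod (h (of_real s * \<xi>)) > l" by simp
      have "continuous_on {0..<1} (\<lambda>s::real. cmod (h (of_real s * \<xi>)))"
        using \<xi> by (intro continuous_intros continuous_on_compose2[OF hc])
          (auto intro!: of_real_mult_circle_in_ball simp del: mem_ball)
      then have "((\<lambda>s::real. cmod (h (of_real s * \<xi>))) \<longlongrightarrow> cmod (h (of_real s * \<xi>))) (at s within {0..<1})"
        using s by (simp add: continuous_on_def)
      then have "\<forall>\<^sub>F t in at s within {0..<1}. cmod (h (of_real t * \<xi>)) > l"
        using gt by (rule order_tendstoD)
      then obtain d where d: "d > 0" "\<And>t. t \<in> {0..<1} \<Longrightarrow> t \<noteq> s \<Longrightarrow> dist t s < d \<Longrightarrow> cmod (h (of_real t * \<xi>)) > l"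
        unfolding eventually_at by blast
      obtain q where q: "q \<in> \<rat>" "s < q" "q < min 1 (s + d)"
        using Rats_dense_in_real[of s "min 1 (s + d)"] s d by auto
      then have "cmod (h (of_real q * \<xi>)) > l"
        using s by (intro d) (auto simp: dist_real_def)
      moreover have "q \<in> R" using q s by (auto simp: R_def)
      ultimately show False using rat by fastforce
    qed
  qed
qed

section \<open>Parseval's identity and square summability of Taylor coefficients\<close>

lemma circle_monomials_orthonormal:
  "(LINT \<xi>|circle_measure. \<xi> ^ i * cnj (\<xi> ^ j)) = (if i = j then 1 else 0)"
proof -
  have *: "(LINT \<xi>|circle_measure. \<xi> ^ i * cnj (\<xi> ^ j)) = (if i = j then 1 else 0)"
    if "j \<le> i" for i j
  proof -
    have "\<xi> ^ i * cnj (\<xi> ^ j) = \<xi> ^ (i - j)" if "\<xi> \<in> space circle_measure" for \<xi>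
    proof -
      have "\<xi> ^ i = \<xi> ^ (i - j) * \<xi> ^ j" using \<open>j \<le> i\<close> by (simp flip: power_add)
      moreover have "\<xi> ^ j * cnj (\<xi> ^ j) = 1"
        using that by (intro cmod_eq_1_cnj) (simp add: norm_power)
      ultimately show ?thesis by (simp add: mult.assoc)
    qed
    then have "(LINT \<xi>|circle_measure. \<xi> ^ i * cnj (\<xi> ^ j)) = (LINT \<xi>|circle_measure. \<xi> ^ (i - j))"
      by (intro Bochner_Integration.integral_cong) auto
    also have "\<dots> = 0 ^ (i - j)"
      by (intro circle_mean_value[of "\<lambda>\<xi>. \<xi> ^ (i - j)"] continuous_intros holomorphic_intros)
    finally show ?thesis using that by (auto simp: power_0_left)
  qed
  show ?thesis
  proof (cases "j \<le> i")
    case False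
    have "cnj (LINT \<xi>|circle_measure. \<xi> ^ j * cnj (\<xi> ^ i))
        = (LINT \<xi>|circle_measure. cnj (\<xi> ^ j * cnj (\<xi> ^ i)))"
      by (rule Bochner_Integration.integral_cnj[symmetric])
    also have "\<dots> = (LINT \<xi>|circle_measure. \<xi> ^ i * cnj (\<xi> ^ j))"
      by (simp only: complex_cnj_mult complex_cnj_cnj mult.commute)
    finally show ?thesis using *[of i j] False by simp
  qed (rule *)
qed

lemma circle_integral_norm_square_poly:
  "(LINT \<xi>|circle_measure. (cmod (\<Sum>n<N. b n * \<xi> ^ n))\<^sup>2) = (\<Sum>n<N. (cmod (b n))\<^sup>2)"
proof -
  have "complex_of_real (LINT \<xi>|circle_measure. (cmod (\<Sum>n<N. b n * \<xi> ^ n))\<^sup>2)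
     = (LINT \<xi>|circle_measure. complex_of_real ((cmod (\<Sum>n<N. b n * \<xi> ^ n))\<^sup>2))"
    by (rule integral_complex_of_real[symmetric])
  also have "\<dots> = (LINT \<xi>|circle_measure. (\<Sum>i<N. \<Sum>j<N. (b i * cnj (b j)) * (\<xi> ^ i * cnj (\<xi> ^ j))))"
    unfolding complex_norm_square cnj_sum sum_product by (simp add: mult_ac)
  also have "\<dots> = (\<Sum>i<N. \<Sum>j<N. (b i * cnj (b j)) * (LINT \<xi>|circle_measure. \<xi> ^ i * cnj (\<xi> ^ j)))"
  proof -
    have int: "integrable circle_measure (\<lambda>\<xi>. \<xi> ^ i * cnj (\<xi> ^ j))" for i j
      by (intro integrable_circle_continuous continuous_intros)
    show ?thesis
      by (simp only: Bochner_Integration.integral_sum Bochner_Integration.integrable_sum int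
          integrable_mult_right integral_mult_right_zero)
  qed
  also have "\<dots> = (\<Sum>i<N. b i * cnj (b i))"
    unfolding circle_monomials_orthonormal by (simp add: if_distrib[of "\<lambda>x. _ * x"] cong: if_cong)
  also have "\<dots> = complex_of_real (\<Sum>n<N. (cmod (b n))\<^sup>2)"
    by (simp only: of_real_sum complex_norm_square)
  finally show ?thesis by (simp only: of_real_eq_iff)
qed

text \<open>The identity for polynomials passes to the limit by dominated convergence, since inside
  the disc the Taylor series converges absolutely and uniformly on the circle of radius
  \<open>s\<close>.\<close>

theorem parseval_disc:
  assumes sums: "\<And>z. z \<in> ball 0 1 \<Longrightarrow> (\<lambda>n. c n * z ^ n) sums h z" and s: "0 \<le> s" "s < 1"
  shows "(\<lambda>n. (cmod (c n))\<^sup>2 * s ^ (2 * n)) sums (LINT \<xi>|circle_measure. (cmod (h (of_real s * \<xi>)))\<^sup>2)"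
proof -
  define b where "b n = c n * of_real s ^ n" for n
  define S where "S N \<xi> = (\<Sum>n<N. b n * \<xi> ^ n)" for N \<xi>
  \<comment> \<open>\<open>(1 + s) / 2\<close> is an auxiliary radius strictly between
    \<open>s\<close> and 1; convergence there implies absolute convergence at
    \<open>s\<close>.\<close>
  have "summable (\<lambda>n. c n * (of_real ((1 + s) / 2)) ^ n)"
    using sums[of "of_real ((1 + s) / 2)"] s
    by (intro sums_summable) (simp del: of_real_divide of_real_add)
  then have "summable (\<lambda>n. cmod (c n * of_real s ^ n))"
    using s by (intro powser_insidea[of c "of_real ((1 + s) / 2)"]) (auto simp del: of_real_divide of_real_add)
  then have sb: "summable (\<lambda>n. cmod (b n))" by (simp add: b_def)
  define B where "B = (\<Sum>n. cmod (b n))"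
  have SB: "cmod (S N \<xi>) \<le> B" if "cmod \<xi> = 1" for N \<xi>
  proof -
    have "cmod (S N \<xi>) \<le> (\<Sum>n<N. cmod (b n))"
      unfolding S_def by (rule sum_norm_le) (simp add: norm_mult norm_power that)
    also have "\<dots> \<le> B" unfolding B_def by (intro sum_le_suminf sb) auto
    finally show ?thesis .
  qed
  have lim: "(\<lambda>N. S N \<xi>) \<longlonglongrightarrow> h (of_real s * \<xi>)" if "cmod \<xi> = 1" for \<xi>
    using sums[OF of_real_mult_circle_in_ball[OF s that]]
    by (simp add: sums_def S_def b_def power_mult_distrib mult_ac)
  have hc: "continuous_on (ball 0 1) h"
    using sums by (intro holomorphic_on_imp_continuous_on power_series_holomorphic[where a = c]) simp
  have "(\<lambda>N. LINT \<xi>|circle_measure. (cmod (S N \<xi>))\<^sup>2) \<longlonglongrightarrow> (LINT \<xi>|circle_measure. (cmod (h (of_real s * \<xi>)))\<^sup>2)"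
  proof (rule integral_dominated_convergence[where w = "\<lambda>_. B\<^sup>2"])
    note [measurable] = measurable_dilate[OF hc s]
    show "(\<lambda>\<xi>. (cmod (h (of_real s * \<xi>)))\<^sup>2) \<in> borel_measurable circle_measure" by measurable
    show "(\<lambda>\<xi>. (cmod (S N \<xi>))\<^sup>2) \<in> borel_measurable circle_measure" for N
      unfolding S_def by (intro borel_measurable_circleI continuous_intros)
    show "AE \<xi> in circle_measure. (\<lambda>N. (cmod (S N \<xi>))\<^sup>2) \<longlonglongrightarrow> (cmod (h (of_real s * \<xi>)))\<^sup>2"
      by (intro AE_I2 tendsto_intros lim) simp
    show "AE \<xi> in circle_measure. norm ((cmod (S N \<xi>))\<^sup>2) \<le> B\<^sup>2" for N
      by (intro AE_I2) (auto intro!: power_mono SB)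
  qed simp
  moreover have "(cmod (b n))\<^sup>2 = (cmod (c n))\<^sup>2 * s ^ (2 * n)" for n
    using s by (simp add: b_def norm_mult norm_power power_mult_distrib flip: power_mult)
      (simp add: mult.commute)
  ultimately show ?thesis
    unfolding S_def circle_integral_norm_square_poly by (simp add: sums_def)
qed

text \<open>Parseval bounds a fixed partial sum by \<open>B^2\<close> on every smaller circle. The
  number of terms is kept fixed while the radius tends to 1.\<close>

lemma power_series_coeffs_square_summable:
  assumes sums: "\<And>z. z \<in> ball 0 1 \<Longrightarrow> (\<lambda>n. c n * z ^ n) sums h z"
    and B: "\<And>z. z \<in> ball 0 1 \<Longrightarrow> cmod (h z) \<le> B"
  shows "summable (\<lambda>n. (cmod (c n))\<^sup>2)"
proof (rule summableI_nonneg_bounded)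
  fix N
  have hc: "continuous_on (ball 0 1) h"
    using sums by (intro holomorphic_on_imp_continuous_on power_series_holomorphic[where a = c]) simp
  have le: "(\<Sum>n<N. (cmod (c n))\<^sup>2 * s ^ (2 * n)) \<le> B\<^sup>2" if s: "0 \<le> s" "s < 1" for s :: real
  proof -
    note ps = parseval_disc[OF sums s]
    have "(\<Sum>n<N. (cmod (c n))\<^sup>2 * s ^ (2 * n)) \<le> (\<Sum>n. (cmod (c n))\<^sup>2 * s ^ (2 * n))"
      using s by (intro sum_le_suminf sums_summable[OF ps]) auto
    also have "\<dots> = (LINT \<xi>|circle_measure. (cmod (h (of_real s * \<xi>)))\<^sup>2)"
      using ps by (rule sums_unique[symmetric])
    also have "\<dots> \<le> B\<^sup>2"
      using s by (intro circle.integral_le_const integrable_circle_continuous continuous_intros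
          continuous_on_subset[OF continuous_on_dilate[OF hc]] AE_I2 power_mono B)
        (auto simp: norm_mult)
    finally show ?thesis .
  qed
  show "(\<Sum>n<N. (cmod (c n))\<^sup>2) \<le> B\<^sup>2"
  proof (rule tendsto_upperbound)
    have "((\<lambda>s::real. \<Sum>n<N. (cmod (c n))\<^sup>2 * s ^ (2 * n)) \<longlongrightarrow> (\<Sum>n<N. (cmod (c n))\<^sup>2 * 1 ^ (2 * n))) (at_left 1)"
      by (intro tendsto_intros)
    then show "((\<lambda>s::real. \<Sum>n<N. (cmod (c n))\<^sup>2 * s ^ (2 * n)) \<longlongrightarrow> (\<Sum>n<N. (cmod (c n))\<^sup>2)) (at_left 1)"
      by simp
    show "\<forall>\<^sub>F s in at_left (1::real). (\<Sum>n<N. (cmod (c n))\<^sup>2 * s ^ (2 * n)) \<le> B\<^sup>2"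
      using eventually_at_left_real[OF zero_less_one] by eventually_elim (auto intro!: le)
  qed simp
qed auto

text \<open>Write \<open>h\<close> as a Taylor polynomial plus a remainder. The polynomial is
  continuous on the closed disc, and the maximal inequality makes the radial supremum of the
  remainder small off a set of small measure, so almost every radius satisfies the Cauchy
  criterion.\<close>

theorem fatou_radial_limits:
  assumes hol: "h holomorphic_on ball 0 1" and B: "\<And>z. z \<in> ball 0 1 \<Longrightarrow> cmod (h z) \<le> B"
  shows "AE \<xi> in circle_measure. \<exists>l. ((\<lambda>r::real. h (of_real r * \<xi>)) \<longlongrightarrow> l) (at_left 1)"
proof -
  let ?M = circle_measure
  define c where "c n = (deriv ^^ n) h 0 / fact n" for n
  have sums: "(\<lambda>n. c n * z ^ n) sums h z" if "z \<in> ball 0 1" for z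
    using holomorphic_power_series[OF hol that] by (simp add: c_def)
  have sc: "summable (\<lambda>n. (cmod (c n))\<^sup>2)"
    by (rule power_series_coeffs_square_summable[OF sums B])
  define p where "p N z = (\<Sum>n<N. c n * z ^ n)" for N z
  define \<tau> where "\<tau> N = (\<Sum>n. (cmod (c n))\<^sup>2) - (\<Sum>n<N. (cmod (c n))\<^sup>2)" for N
  have "\<tau> \<longlonglongrightarrow> (\<Sum>n. (cmod (c n))\<^sup>2) - (\<Sum>n. (cmod (c n))\<^sup>2)"
    unfolding \<tau>_def by (intro tendsto_intros summable_LIMSEQ sc)
  then have \<tau>0: "\<tau> \<longlonglongrightarrow> 0" by simp
  have tail: "(\<integral>\<^sup>+\<xi>. ennreal ((cmod (h (of_real s * \<xi>) - p N (of_real s * \<xi>)))\<^sup>2) \<partial>?M) \<le> ennreal (\<tau> N)"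
    if s: "0 \<le> s" "s < 1" for s N
  proof -
    \<comment> \<open>The remainder has the Taylor coefficients from index \<open>N\<close> on, so
      Parseval bounds its square mean on each circle by the tail \<open>\<tau> N\<close>.\<close>
    define c' where "c' n = (if n < N then 0 else c n)" for n
    have c'_sums: "(\<lambda>n. c' n * z ^ n) sums (h z - p N z)" if "z \<in> ball 0 1" for z
    proof -
      have "(\<lambda>n. c n * z ^ n - (if n \<in> {..<N} then c n * z ^ n else 0)) sums (h z - (\<Sum>n\<in>{..<N}. c n * z ^ n))"
        by (intro sums_diff sums that sums_If_finite_set) auto
      also have "(\<lambda>n. c n * z ^ n - (if n \<in> {..<N} then c n * z ^ n else 0)) = (\<lambda>n. c' n * z ^ n)"
        by (auto simp: c'_def)
      finally show ?thesis by (simp add: p_def)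
    qed
    have "(\<lambda>n. (cmod (c n))\<^sup>2 - (if n \<in> {..<N} then (cmod (c n))\<^sup>2 else 0)) sums \<tau> N"
      unfolding \<tau>_def by (intro sums_diff summable_sums sc sums_If_finite_set) auto
    also have "(\<lambda>n. (cmod (c n))\<^sup>2 - (if n \<in> {..<N} then (cmod (c n))\<^sup>2 else 0)) = (\<lambda>n. (cmod (c' n))\<^sup>2)"
      by (auto simp: c'_def)
    finally have \<tau>: "(\<lambda>n. (cmod (c' n))\<^sup>2) sums \<tau> N" .
    have le: "(LINT \<xi>|?M. (cmod (h (of_real s * \<xi>) - p N (of_real s * \<xi>)))\<^sup>2) \<le> \<tau> N"
    proof (rule sums_le[OF _ parseval_disc[OF c'_sums s] \<tau>])
      show "(cmod (c' n))\<^sup>2 * s ^ (2 * n) \<le> (cmod (c' n))\<^sup>2" for n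
        using s by (intro mult_left_le) (auto simp: power_le_one)
    qed
    have "continuous_on (ball 0 1) (\<lambda>z. h z - p N z)"
      unfolding p_def by (intro continuous_intros holomorphic_on_imp_continuous_on[OF hol])
    from continuous_on_dilate[OF this s]
    have "continuous_on (sphere 0 1) (\<lambda>\<xi>. h (of_real s * \<xi>) - p N (of_real s * \<xi>))"
      by (rule continuous_on_subset) auto
    then have "integrable ?M (\<lambda>\<xi>. (cmod (h (of_real s * \<xi>) - p N (of_real s * \<xi>)))\<^sup>2)"
      by (intro integrable_circle_continuous continuous_on_power continuous_on_norm)
    then show ?thesis using le by (subst nn_integral_eq_integral) (auto intro: ennreal_leI)
  qed
  have hpol: "(\<lambda>z. h z - p N z) holomorphic_on ball 0 1" for N
    unfolding p_def by (intro holomorphic_intros hol)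
  have ex: "\<exists>E. E \<in> sets ?M \<and> ennreal (l\<^sup>2) * emeasure ?M E \<le> 256 * ennreal (\<tau> N) \<and>
      (\<forall>\<xi> s. \<xi> \<in> space ?M - E \<longrightarrow> 0 \<le> s \<longrightarrow> s < 1 \<longrightarrow> cmod (h (of_real s * \<xi>) - p N (of_real s * \<xi>)) \<le> l)"
    if "l > 0" for l N
    by (rule radial_maximal_inequality[OF hpol tail that]) blast+
  have AE_l: "AE \<xi> in ?M. \<exists>N. \<forall>s. 0 \<le> s \<longrightarrow> s < 1 \<longrightarrow> cmod (h (of_real s * \<xi>) - p N (of_real s * \<xi>)) \<le> l"
    if l: "l > 0" for l
  proof -
    obtain E where E: "\<And>N. E N \<in> sets ?M" "\<And>N. ennreal (l\<^sup>2) * emeasure ?M (E N) \<le> 256 * ennreal (\<tau> N)"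
      "\<And>N \<xi> s. \<xi> \<in> space ?M - E N \<Longrightarrow> 0 \<le> s \<Longrightarrow> s < 1 \<Longrightarrow> cmod (h (of_real s * \<xi>) - p N (of_real s * \<xi>)) \<le> l"
      using ex[OF l] by metis
    \<comment> \<open>A point lying outside a single \<open>E N\<close> already has a good
      \<open>N\<close>. The bad points are in the intersection, whose measure is controlled by every
      \<open>\<tau> N\<close> and is therefore zero.\<close>
    have "ennreal (l\<^sup>2) * emeasure ?M (\<Inter>N. E N) \<le> 0"
    proof (rule tendsto_lowerbound)
      have "(\<lambda>N. ennreal (256 * \<tau> N)) \<longlonglongrightarrow> ennreal (256 * 0)"
        by (intro tendsto_ennrealI tendsto_intros \<tau>0)
      then show "(\<lambda>N. ennreal (256 * \<tau> N)) \<longlonglongrightarrow> 0" by simp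
      have "ennreal (l\<^sup>2) * emeasure ?M (\<Inter>N. E N) \<le> ennreal (256 * \<tau> N)" for N
      proof -
        have "ennreal (l\<^sup>2) * emeasure ?M (\<Inter>N. E N) \<le> ennreal (l\<^sup>2) * emeasure ?M (E N)"
          using E(1) by (intro mult_left_mono emeasure_mono) auto
        also have "\<dots> \<le> 256 * ennreal (\<tau> N)" by (rule E)
        also have "\<dots> = ennreal (256 * \<tau> N)" by (simp add: ennreal_mult')
        finally show ?thesis .
      qed
      then show "\<forall>\<^sub>F N in sequentially. ennreal (l\<^sup>2) * emeasure ?M (\<Inter>N. E N) \<le> ennreal (256 * \<tau> N)"
        by simp
    qed simp
    then have "emeasure ?M (\<Inter>N. E N) = 0" using l by simp
    moreover have "(\<Inter>N. E N) \<in> sets ?M" using E(1) by auto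
    ultimately have "(\<Inter>N. E N) \<in> null_sets ?M" by auto
    then show ?thesis
      by (rule AE_I') (use E(3) in blast)
  qed
  have "AE \<xi> in ?M. \<forall>j::nat. \<exists>N. \<forall>s. 0 \<le> s \<longrightarrow> s < 1 \<longrightarrow>
      cmod (h (of_real s * \<xi>) - p N (of_real s * \<xi>)) \<le> 1 / real (Suc j)"
    unfolding AE_all_countable by (intro allI AE_l) simp
  then show ?thesis
  proof eventually_elim
    case (elim \<xi>)
    have "cauchy_filter (filtermap (\<lambda>r. h (of_real r * \<xi>)) (at_left (1::real)))"
      unfolding cauchy_filter_metric_filtermap
    proof (intro allI impI)
      fix e :: real assume e: "e > 0"
      then obtain j where j: "1 / real (Suc j) < e / 4"
        by (metis nat_approx_posE zero_less_divide_iff zero_less_numeral)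
      \<comment> \<open>\<open>N\<close> may depend on the point but serves all radii at once. Two
        remainder errors and two polynomial errors, each below \<open>e / 4\<close>, make up
        \<open>e\<close>.\<close>
      obtain N where N: "\<And>s. 0 \<le> s \<Longrightarrow> s < 1 \<Longrightarrow> cmod (h (of_real s * \<xi>) - p N (of_real s * \<xi>)) \<le> 1 / real (Suc j)"
        using elim by blast
      have "((\<lambda>r::real. p N (of_real r * \<xi>)) \<longlongrightarrow> p N (of_real 1 * \<xi>)) (at_left 1)"
        unfolding p_def by (intro tendsto_intros)
      then have "\<forall>\<^sub>F r in at_left (1::real). dist (p N (of_real r * \<xi>)) (p N (of_real 1 * \<xi>)) < e / 4"
        by (rule tendstoD) (use e in simp)
      then have "\<forall>\<^sub>F r in at_left (1::real). dist (p N (of_real r * \<xi>)) (p N (of_real 1 * \<xi>)) < e / 4 \<and> 0 < r \<and> r < 1"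
        using eventually_at_left_real[OF zero_less_one] by eventually_elim auto
      moreover have "dist (h (of_real x * \<xi>)) (h (of_real y * \<xi>)) < e"
        if "dist (p N (of_real x * \<xi>)) (p N (of_real 1 * \<xi>)) < e / 4 \<and> 0 < x \<and> x < 1"
          "dist (p N (of_real y * \<xi>)) (p N (of_real 1 * \<xi>)) < e / 4 \<and> 0 < y \<and> y < 1" for x y :: real
      proof -
        have "dist (h (of_real x * \<xi>)) (p N (of_real x * \<xi>)) < e / 4"
          "dist (h (of_real y * \<xi>)) (p N (of_real y * \<xi>)) < e / 4"
          using N[of x] N[of y] that j by (auto simp: dist_norm)
        moreover have "dist (h (of_real x * \<xi>)) (h (of_real y * \<xi>))
            \<le> dist (h (of_real x * \<xi>)) (p N (of_real 1 * \<xi>)) + dist (h (of_real y * \<xi>)) (p N (of_real 1 * \<xi>))"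
          by (rule dist_triangle2)
        moreover have "dist (h (of_real t * \<xi>)) (p N (of_real 1 * \<xi>))
            \<le> dist (h (of_real t * \<xi>)) (p N (of_real t * \<xi>)) + dist (p N (of_real t * \<xi>)) (p N (of_real 1 * \<xi>))" for t :: real
          by (rule dist_triangle)
        from this[of x] this[of y] have "dist (h (of_real x * \<xi>)) (p N (of_real 1 * \<xi>)) + dist (h (of_real y * \<xi>)) (p N (of_real 1 * \<xi>))
            \<le> (dist (h (of_real x * \<xi>)) (p N (of_real x * \<xi>)) + dist (p N (of_real x * \<xi>)) (p N (of_real 1 * \<xi>)))
             + (dist (h (of_real y * \<xi>)) (p N (of_real y * \<xi>)) + dist (p N (of_real y * \<xi>)) (p N (of_real 1 * \<xi>)))"
          by (rule add_mono)
        ultimately show ?thesis using that by linarith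
      qed
      ultimately show "\<exists>P. eventually P (at_left 1) \<and>
          (\<forall>x y. P x \<and> P y \<longrightarrow> dist (h (of_real x * \<xi>)) (h (of_real y * \<xi>)) < e)"
        by (intro exI[of _ "\<lambda>r. dist (p N (of_real r * \<xi>)) (p N (of_real 1 * \<xi>)) < e / 4 \<and> 0 < r \<and> r < 1"] conjI) auto
    qed
    then have "\<exists>l. filtermap (\<lambda>r. h (of_real r * \<xi>)) (at_left (1::real)) \<le> nhds l"
      by (rule cauchy_filter_complete_converges[OF _ complete_UNIV]) (auto simp: filtermap_bot_iff)
    then show ?case
      by (simp add: filterlim_def)
  qed
qed

section \<open>Boundary values\<close>

text \<open>Membership in L-infinity of the circle. The class is an algebra contained in L1, so
  closure rules alone settle the integrability and measurability conditions whenever an integral is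
  split.\<close>

definition ess_bounded :: "(complex \<Rightarrow> complex) \<Rightarrow> bool" where
  "ess_bounded u \<longleftrightarrow> u \<in> borel_measurable circle_measure \<and> (\<exists>B. AE \<xi> in circle_measure. cmod (u \<xi>) \<le> B)"

named_theorems ess_bounded_intros

lemma ess_boundedI:
  "u \<in> borel_measurable circle_measure \<Longrightarrow> AE \<xi> in circle_measure. cmod (u \<xi>) \<le> B \<Longrightarrow> ess_bounded u"
  by (auto simp: ess_bounded_def)

lemma ess_bounded_measurable: "ess_bounded u \<Longrightarrow> u \<in> borel_measurable circle_measure"
  by (simp add: ess_bounded_def)

lemma ess_bounded_integrable: "ess_bounded u \<Longrightarrow> integrable circle_measure u"
  unfolding ess_bounded_def by (auto intro: circle.integrable_const_bound)

lemma ess_bounded_continuous: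
  assumes "continuous_on (sphere 0 1) u"
  shows "ess_bounded u"
proof -
  have "bounded (u ` sphere 0 1)"
    by (intro compact_imp_bounded compact_continuous_image assms) auto
  then obtain B where "\<forall>\<xi>\<in>sphere 0 1. cmod (u \<xi>) \<le> B"
    unfolding bounded_iff by blast
  then show ?thesis
    by (intro ess_boundedI[where B = B] AE_I2 borel_measurable_circleI assms) auto
qed

lemma ess_bounded_const [ess_bounded_intros]: "ess_bounded (\<lambda>_. c)"
  by (intro ess_bounded_continuous continuous_intros)

lemma ess_bounded_poisson_kernel [ess_bounded_intros]:
  "z \<in> ball 0 1 \<Longrightarrow> ess_bounded (\<lambda>\<xi>. of_real (poisson_kernel z \<xi>))"
  by (intro ess_bounded_continuous continuous_intros)

lemma ess_bounded_cnj [ess_bounded_intros]: "ess_bounded u \<Longrightarrow> ess_bounded (\<lambda>\<xi>. cnj (u \<xi>))"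
  unfolding ess_bounded_def
  by (auto intro: measurable_compose[OF _ borel_measurable_continuous_onI[OF continuous_on_cnj[OF continuous_on_id]]])

lemma ess_bounded_add [ess_bounded_intros]:
  assumes "ess_bounded u" "ess_bounded v"
  shows "ess_bounded (\<lambda>\<xi>. u \<xi> + v \<xi>)"
proof -
  from assms obtain A B where "AE \<xi> in circle_measure. cmod (u \<xi>) \<le> A" "AE \<xi> in circle_measure. cmod (v \<xi>) \<le> B"
    by (auto simp: ess_bounded_def)
  then have "AE \<xi> in circle_measure. cmod (u \<xi> + v \<xi>) \<le> A + B"
    by eventually_elim (rule norm_triangle_mono)
  with assms show ?thesis by (intro ess_boundedI[where B = "A + B"]) (auto simp: ess_bounded_def)
qed

lemma ess_bounded_mult [ess_bounded_intros]:
  assumes "ess_bounded u" "ess_bounded v"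
  shows "ess_bounded (\<lambda>\<xi>. u \<xi> * v \<xi>)"
proof -
  from assms obtain A B where "AE \<xi> in circle_measure. cmod (u \<xi>) \<le> A" "AE \<xi> in circle_measure. cmod (v \<xi>) \<le> B"
    by (auto simp: ess_bounded_def)
  then have "AE \<xi> in circle_measure. cmod (u \<xi> * v \<xi>) \<le> A * B"
  proof eventually_elim
    case (elim \<xi>)
    have "0 \<le> A" using elim(1) norm_ge_zero[of "u \<xi>"] by linarith
    then show ?case using elim by (auto simp: norm_mult intro: mult_mono)
  qed
  with assms show ?thesis by (intro ess_boundedI[where B = "A * B"]) (auto simp: ess_bounded_def)
qed

lemma ess_bounded_diff [ess_bounded_intros]:
  assumes "ess_bounded u" "ess_bounded v"
  shows "ess_bounded (\<lambda>\<xi>. u \<xi> - v \<xi>)"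
  using ess_bounded_add[OF assms(1) ess_bounded_mult[OF ess_bounded_const[of "-1"] assms(2)]] by simp

lemma ess_bounded_power [ess_bounded_intros]: "ess_bounded u \<Longrightarrow> ess_bounded (\<lambda>\<xi>. u \<xi> ^ n)"
  by (induction n) (auto intro!: ess_bounded_intros)

lemma ess_bounded_sum [ess_bounded_intros]:
  "(\<And>i. i \<in> I \<Longrightarrow> ess_bounded (u i)) \<Longrightarrow> ess_bounded (\<lambda>\<xi>. \<Sum>i\<in>I. u i \<xi>)"
  by (induction I rule: infinite_finite_induct) (auto intro!: ess_bounded_intros)

section \<open>The algebra of bounded holomorphic functions on the disc (H-infinity)\<close>

definition hinf :: "(complex \<Rightarrow> complex) \<Rightarrow> bool" where
  "hinf h \<longleftrightarrow> h holomorphic_on ball 0 1 \<and> bounded (h ` ball 0 1)"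

named_theorems hinf_intros

lemma hinfI: "h holomorphic_on ball 0 1 \<Longrightarrow> (\<And>z. z \<in> ball 0 1 \<Longrightarrow> cmod (h z) \<le> B) \<Longrightarrow> hinf h"
  unfolding hinf_def bounded_iff by blast

lemma hinfE:
  assumes "hinf h"
  obtains B where "h holomorphic_on ball 0 1" "\<And>z. z \<in> ball 0 1 \<Longrightarrow> cmod (h z) \<le> B"
  using assms unfolding hinf_def bounded_iff by blast

lemma hinf_holomorphic: "hinf h \<Longrightarrow> h holomorphic_on ball 0 1"
  by (simp add: hinf_def)

lemma hinf_continuous: "hinf h \<Longrightarrow> continuous_on (ball 0 1) h"
  by (simp add: hinf_def holomorphic_on_imp_continuous_on)

lemma hinf_const [hinf_intros]: "hinf (\<lambda>_. c)"
  by (rule hinfI[where B = "cmod c"]) auto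

lemma hinf_ident [hinf_intros]: "hinf (\<lambda>z. z)"
  by (rule hinfI[where B = 1]) auto

lemma hinf_add [hinf_intros]:
  assumes "hinf h" "hinf k"
  shows "hinf (\<lambda>z. h z + k z)"
proof -
  obtain A where A: "h holomorphic_on ball 0 1" "\<And>z. z \<in> ball 0 1 \<Longrightarrow> cmod (h z) \<le> A"
    using assms(1) by (rule hinfE) (rule that)
  obtain B where B: "k holomorphic_on ball 0 1" "\<And>z. z \<in> ball 0 1 \<Longrightarrow> cmod (k z) \<le> B"
    using assms(2) by (rule hinfE) (rule that)
  show ?thesis
    using A B by (intro hinfI[where B = "A + B"] holomorphic_intros norm_triangle_mono)
qed

lemma hinf_mult [hinf_intros]:
  assumes "hinf h" "hinf k"
  shows "hinf (\<lambda>z. h z * k z)"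
proof -
  obtain A where A: "h holomorphic_on ball 0 1" "\<And>z. z \<in> ball 0 1 \<Longrightarrow> cmod (h z) \<le> A"
    using assms(1) by (rule hinfE) (rule that)
  obtain B where B: "k holomorphic_on ball 0 1" "\<And>z. z \<in> ball 0 1 \<Longrightarrow> cmod (k z) \<le> B"
    using assms(2) by (rule hinfE) (rule that)
  have "0 \<le> A" using A(2)[of 0] norm_ge_zero[of "h 0"] by (simp del: norm_ge_zero)
  then show ?thesis
    using A B by (intro hinfI[where B = "A * B"] holomorphic_intros) (auto simp: norm_mult intro!: mult_mono)
qed

lemma hinf_power [hinf_intros]: "hinf h \<Longrightarrow> hinf (\<lambda>z. h z ^ n)"
  by (induction n) (auto intro!: hinf_intros)

lemma hinf_self_map: "h holomorphic_on ball 0 1 \<Longrightarrow> h ` ball 0 1 \<subseteq> ball 0 1 \<Longrightarrow> hinf h"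
  by (rule hinfI[where B = 1]) fastforce+

lemma hinf_compose:
  assumes "hinf h" "g holomorphic_on ball 0 1" "g ` ball 0 1 \<subseteq> ball 0 1"
  shows "hinf (\<lambda>z. h (g z))"
proof -
  obtain B where B: "h holomorphic_on ball 0 1" "\<And>z. z \<in> ball 0 1 \<Longrightarrow> cmod (h z) \<le> B"
    using assms(1) by (rule hinfE) (rule that)
  have "(h \<circ> g) holomorphic_on ball 0 1"
    by (rule holomorphic_on_compose_gen[OF assms(2) B(1) assms(3)])
  moreover have "cmod (h (g z)) \<le> B" if "z \<in> ball 0 1" for z
    using B(2) assms(3) that by blast
  ultimately show ?thesis
    by (intro hinfI[where B = B]) (simp_all add: o_def)
qed

text \<open>Along a fixed sequence of radii the limit function is Borel measurable outright, whereas
  \<^const>\<open>radial_limit\<close> is only almost everywhere equal to a measurable function.\<close>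

definition exhaustion_radius :: "nat \<Rightarrow> real" where
  "exhaustion_radius n = 1 - inverse (real (Suc n))"

definition boundary_value :: "(complex \<Rightarrow> complex) \<Rightarrow> complex \<Rightarrow> complex" where
  "boundary_value h \<xi> = lim (\<lambda>n. h (of_real (exhaustion_radius n) * \<xi>))"

section \<open>Existence, measurability and multiplicativity of boundary values\<close>

lemma exhaustion_radius: "0 \<le> exhaustion_radius n" "exhaustion_radius n < 1"
  by (auto simp: exhaustion_radius_def field_simps)

lemma exhaustion_radius_at_left: "filterlim exhaustion_radius (at_left 1) sequentially"
  unfolding filterlim_at
proof
  have "exhaustion_radius \<longlonglongrightarrow> 1 - 0"
    unfolding exhaustion_radius_def[abs_def] by (intro tendsto_diff tendsto_const LIMSEQ_inverse_real_of_nat)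
  then show "exhaustion_radius \<longlonglongrightarrow> 1" by simp
  show "\<forall>\<^sub>F n in sequentially. exhaustion_radius n \<in> {..<1} \<and> exhaustion_radius n \<noteq> 1"
    using exhaustion_radius(2) by (auto simp: less_imp_neq)
qed

lemma boundary_value_eqI:
  assumes "((\<lambda>r::real. h (of_real r * \<xi>)) \<longlongrightarrow> l) (at_left 1)"
  shows "(\<lambda>n. h (of_real (exhaustion_radius n) * \<xi>)) \<longlonglongrightarrow> l" "boundary_value h \<xi> = l" "radial_limit h \<xi> = l"
proof -
  show "(\<lambda>n. h (of_real (exhaustion_radius n) * \<xi>)) \<longlonglongrightarrow> l"
    by (rule filterlim_compose[OF assms exhaustion_radius_at_left])
  then show "boundary_value h \<xi> = l" unfolding boundary_value_def by (rule limI)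
  show "radial_limit h \<xi> = l"
    unfolding radial_limit_def by (rule tendsto_Lim[OF _ assms]) simp
qed

lemma AE_tendsto_boundary_value:
  assumes "hinf h"
  shows "AE \<xi> in circle_measure. (\<lambda>n. h (of_real (exhaustion_radius n) * \<xi>)) \<longlonglongrightarrow> boundary_value h \<xi>"
    and "AE \<xi> in circle_measure. radial_limit h \<xi> = boundary_value h \<xi>"
proof -
  have "AE \<xi> in circle_measure. \<exists>l. ((\<lambda>r::real. h (of_real r * \<xi>)) \<longlongrightarrow> l) (at_left 1)"
    using assms by (elim hinfE) (rule fatou_radial_limits)
  then have "AE \<xi> in circle_measure. (\<lambda>n. h (of_real (exhaustion_radius n) * \<xi>)) \<longlonglongrightarrow> boundary_value h \<xi>
      \<and> radial_limit h \<xi> = boundary_value h \<xi>"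
    by eventually_elim (use boundary_value_eqI in blast)
  then show "AE \<xi> in circle_measure. (\<lambda>n. h (of_real (exhaustion_radius n) * \<xi>)) \<longlonglongrightarrow> boundary_value h \<xi>"
    and "AE \<xi> in circle_measure. radial_limit h \<xi> = boundary_value h \<xi>"
    by auto
qed

lemma exhaustion_radius_in_ball:
  "\<xi> \<in> space circle_measure \<Longrightarrow> of_real (exhaustion_radius n) * \<xi> \<in> ball 0 1"
  using exhaustion_radius by (intro of_real_mult_circle_in_ball) auto

lemma measurable_boundary_value:
  assumes "hinf h"
  shows "boundary_value h \<in> borel_measurable circle_measure"
proof -
  have [measurable]: "(\<lambda>\<xi>. h (of_real (exhaustion_radius n) * \<xi>)) \<in> borel_measurable circle_measure" for n
    by (intro measurable_dilate hinf_continuous assms exhaustion_radius)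
  show ?thesis unfolding boundary_value_def[abs_def] by measurable
qed

lemma AE_boundary_value_le:
  assumes "hinf h" "\<And>z. z \<in> ball 0 1 \<Longrightarrow> cmod (h z) \<le> B"
  shows "AE \<xi> in circle_measure. cmod (boundary_value h \<xi>) \<le> B"
  using AE_tendsto_boundary_value(1)[OF assms(1)] AE_space
proof eventually_elim
  case (elim \<xi>)
  show ?case
  proof (rule tendsto_upperbound)
    show "(\<lambda>n. cmod (h (of_real (exhaustion_radius n) * \<xi>))) \<longlonglongrightarrow> cmod (boundary_value h \<xi>)"
      using elim(1) by (rule tendsto_norm)
    show "\<forall>\<^sub>F n in sequentially. cmod (h (of_real (exhaustion_radius n) * \<xi>)) \<le> B"
      using exhaustion_radius_in_ball[OF elim(2)] by (intro always_eventually allI assms(2))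
  qed simp
qed

lemma ess_bounded_boundary_value [ess_bounded_intros]:
  assumes "hinf h"
  shows "ess_bounded (boundary_value h)"
proof -
  obtain B where "\<And>z. z \<in> ball 0 1 \<Longrightarrow> cmod (h z) \<le> B"
    using assms by (rule hinfE) (rule that)
  then show ?thesis
    using assms by (intro ess_boundedI[where B = B] measurable_boundary_value AE_boundary_value_le)
qed

lemma AE_boundary_value_unique:
  assumes "hinf k" "AE \<xi> in circle_measure. (\<lambda>n. k (of_real (exhaustion_radius n) * \<xi>)) \<longlonglongrightarrow> u \<xi>"
  shows "AE \<xi> in circle_measure. boundary_value k \<xi> = u \<xi>"
  using AE_tendsto_boundary_value(1)[OF assms(1)] assms(2)
  by eventually_elim (rule LIMSEQ_unique)

lemma AE_boundary_value_cong:
  assumes "\<And>z. z \<in> ball 0 1 \<Longrightarrow> h z = k z"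
  shows "AE \<xi> in circle_measure. boundary_value h \<xi> = boundary_value k \<xi>"
  using AE_space
proof eventually_elim
  case (elim \<xi>)
  then show ?case
    unfolding boundary_value_def
    by (simp only: assms[OF exhaustion_radius_in_ball[OF elim]])
qed

lemma AE_boundary_value_ident: "AE \<xi> in circle_measure. boundary_value (\<lambda>z. z) \<xi> = \<xi>"
proof (rule AE_boundary_value_unique[OF hinf_ident], rule AE_I2)
  fix \<xi> :: complex
  have "exhaustion_radius \<longlonglongrightarrow> 1"
    using exhaustion_radius_at_left by (simp add: filterlim_at)
  then have "(\<lambda>n. of_real (exhaustion_radius n) * \<xi>) \<longlonglongrightarrow> of_real 1 * \<xi>"
    by (intro tendsto_intros)
  then show "(\<lambda>n. of_real (exhaustion_radius n) * \<xi>) \<longlonglongrightarrow> \<xi>" by simp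
qed

lemma AE_boundary_value_const: "AE \<xi> in circle_measure. boundary_value (\<lambda>_. c) \<xi> = c"
  by (rule AE_boundary_value_unique[OF hinf_const]) simp

lemma AE_boundary_value_add:
  assumes "hinf h" "hinf k"
  shows "AE \<xi> in circle_measure. boundary_value (\<lambda>z. h z + k z) \<xi> = boundary_value h \<xi> + boundary_value k \<xi>"
proof (rule AE_boundary_value_unique)
  show "AE \<xi> in circle_measure. (\<lambda>n. h (of_real (exhaustion_radius n) * \<xi>) + k (of_real (exhaustion_radius n) * \<xi>))
      \<longlonglongrightarrow> boundary_value h \<xi> + boundary_value k \<xi>"
    using AE_tendsto_boundary_value(1)[OF assms(1)] AE_tendsto_boundary_value(1)[OF assms(2)]
    by eventually_elim (rule tendsto_add)
qed (intro hinf_intros assms)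

lemma AE_boundary_value_mult:
  assumes "hinf h" "hinf k"
  shows "AE \<xi> in circle_measure. boundary_value (\<lambda>z. h z * k z) \<xi> = boundary_value h \<xi> * boundary_value k \<xi>"
proof (rule AE_boundary_value_unique)
  show "AE \<xi> in circle_measure. (\<lambda>n. h (of_real (exhaustion_radius n) * \<xi>) * k (of_real (exhaustion_radius n) * \<xi>))
      \<longlonglongrightarrow> boundary_value h \<xi> * boundary_value k \<xi>"
    using AE_tendsto_boundary_value(1)[OF assms(1)] AE_tendsto_boundary_value(1)[OF assms(2)]
    by eventually_elim (rule tendsto_mult)
qed (intro hinf_intros assms)

lemma AE_boundary_value_power:
  assumes "hinf h"
  shows "AE \<xi> in circle_measure. boundary_value (\<lambda>z. h z ^ n) \<xi> = boundary_value h \<xi> ^ n"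
proof (rule AE_boundary_value_unique)
  show "AE \<xi> in circle_measure. (\<lambda>m. h (of_real (exhaustion_radius m) * \<xi>) ^ n) \<longlonglongrightarrow> boundary_value h \<xi> ^ n"
    using AE_tendsto_boundary_value(1)[OF assms(1)]
    by eventually_elim (rule tendsto_power)
qed (intro hinf_intros assms)

text \<open>The dilates of \<open>h\<close> are continuous on the closed disc and satisfy the
  Poisson formula. Both sides converge along the exhausting radii, the left one by dominated
  convergence.\<close>

theorem poisson_formula_boundary_value:
  assumes h: "hinf h" and z: "z \<in> ball 0 1"
  shows "(LINT \<xi>|circle_measure. boundary_value h \<xi> * poisson_kernel z \<xi>) = h z"
proof (rule LIMSEQ_unique)
  obtain B where B: "\<And>z. z \<in> ball 0 1 \<Longrightarrow> cmod (h z) \<le> B" using h by (rule hinfE) (rule that)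
  note bv [measurable] = measurable_boundary_value[OF h]
  have dm [measurable]: "(\<lambda>\<xi>. h (of_real (exhaustion_radius n) * \<xi>)) \<in> borel_measurable circle_measure" for n
    by (intro measurable_dilate hinf_continuous h exhaustion_radius)
  have "integrable circle_measure (\<lambda>\<xi>. B * poisson_kernel z \<xi>)"
    using z by (intro integrable_circle_continuous continuous_intros)
  then show "(\<lambda>n. LINT \<xi>|circle_measure. h (of_real (exhaustion_radius n) * \<xi>) * poisson_kernel z \<xi>)
     \<longlonglongrightarrow> (LINT \<xi>|circle_measure. boundary_value h \<xi> * poisson_kernel z \<xi>)"
  proof (rule integral_dominated_convergence[rotated 2])
    show "AE \<xi> in circle_measure. (\<lambda>n. h (of_real (exhaustion_radius n) * \<xi>) * poisson_kernel z \<xi>)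
        \<longlonglongrightarrow> boundary_value h \<xi> * poisson_kernel z \<xi>"
      using AE_tendsto_boundary_value(1)[OF h] by eventually_elim (intro tendsto_intros)
    show "AE \<xi> in circle_measure. cmod (h (of_real (exhaustion_radius n) * \<xi>) * poisson_kernel z \<xi>) \<le> B * poisson_kernel z \<xi>" for n
      using poisson_kernel_nonneg[OF z] B[OF exhaustion_radius_in_ball]
      by (intro AE_I2) (auto simp: norm_mult intro!: mult_right_mono)
  qed measurable
  have "(LINT \<xi>|circle_measure. h (of_real (exhaustion_radius n) * \<xi>) * poisson_kernel z \<xi>)
      = h (of_real (exhaustion_radius n) * z)" for n
    using exhaustion_radius[of n]
    by (intro poisson_formula[OF _ _ z] continuous_on_dilate holomorphic_on_dilate hinf_continuous
        hinf_holomorphic h) auto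
  moreover have "(\<lambda>n. h (of_real (exhaustion_radius n) * z)) \<longlonglongrightarrow> h z"
  proof (rule isCont_tendsto_compose[where g = h])
    show "isCont h z"
      using hinf_continuous[OF h] z by (simp add: continuous_on_eq_continuous_at del: mem_ball)
    have "exhaustion_radius \<longlonglongrightarrow> 1"
      using exhaustion_radius_at_left by (simp add: filterlim_at)
    then have "(\<lambda>n. of_real (exhaustion_radius n) * z) \<longlonglongrightarrow> of_real 1 * z"
      by (intro tendsto_intros)
    then show "(\<lambda>n. of_real (exhaustion_radius n) * z) \<longlonglongrightarrow> z" by simp
  qed
  ultimately show "(\<lambda>n. LINT \<xi>|circle_measure. h (of_real (exhaustion_radius n) * \<xi>) * poisson_kernel z \<xi>)
     \<longlonglongrightarrow> h z" by simp
qed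

lemma integral_boundary_value: 
  assumes "hinf h"
  shows "(LINT \<xi>|circle_measure. boundary_value h \<xi>) = h 0"
proof -
  have "(LINT \<xi>|circle_measure. boundary_value h \<xi>) = (LINT \<xi>|circle_measure. boundary_value h \<xi> * poisson_kernel 0 \<xi>)"
    by (intro Bochner_Integration.integral_cong) (auto simp: poisson_kernel_def)
  then show ?thesis using poisson_formula_boundary_value[OF assms, of 0] by simp
qed

text \<open>Dominated convergence along the exhausting radii, with Parseval on each circle. For an
  inner function the second claim shows that the coefficient sum is at least 1.\<close>

lemma integral_norm_square_boundary_value_le:
  assumes h: "hinf h" and sums: "\<And>z. z \<in> ball 0 1 \<Longrightarrow> (\<lambda>n. c n * z ^ n) sums h z"
  shows "summable (\<lambda>n. (cmod (c n))\<^sup>2)"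
    and "(LINT \<xi>|circle_measure. (cmod (boundary_value h \<xi>))\<^sup>2) \<le> (\<Sum>n. (cmod (c n))\<^sup>2)"
proof -
  obtain B where B: "\<And>z. z \<in> ball 0 1 \<Longrightarrow> cmod (h z) \<le> B" using h by (rule hinfE) (rule that)
  note bv [measurable] = measurable_boundary_value[OF h]
  have dm [measurable]: "(\<lambda>\<xi>. h (of_real (exhaustion_radius n) * \<xi>)) \<in> borel_measurable circle_measure" for n
    by (intro measurable_dilate hinf_continuous h exhaustion_radius)
  show sc: "summable (\<lambda>n. (cmod (c n))\<^sup>2)"
    by (rule power_series_coeffs_square_summable[OF sums B])
  have "(\<lambda>n. LINT \<xi>|circle_measure. (cmod (h (of_real (exhaustion_radius n) * \<xi>)))\<^sup>2)
     \<longlonglongrightarrow> (LINT \<xi>|circle_measure. (cmod (boundary_value h \<xi>))\<^sup>2)"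
  proof (rule integral_dominated_convergence[where w = "\<lambda>_. B\<^sup>2"])
    show "AE \<xi> in circle_measure. (\<lambda>n. (cmod (h (of_real (exhaustion_radius n) * \<xi>)))\<^sup>2)
        \<longlonglongrightarrow> (cmod (boundary_value h \<xi>))\<^sup>2"
      using AE_tendsto_boundary_value(1)[OF h] by eventually_elim (intro tendsto_intros)
    show "AE \<xi> in circle_measure. norm ((cmod (h (of_real (exhaustion_radius n) * \<xi>)))\<^sup>2) \<le> B\<^sup>2" for n
      using B[OF exhaustion_radius_in_ball] by (intro AE_I2) (auto intro!: power_mono)
  qed auto
  then show "(LINT \<xi>|circle_measure. (cmod (boundary_value h \<xi>))\<^sup>2) \<le> (\<Sum>n. (cmod (c n))\<^sup>2)"
  proof (rule tendsto_upperbound)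
    have "(LINT \<xi>|circle_measure. (cmod (h (of_real (exhaustion_radius n) * \<xi>)))\<^sup>2) \<le> (\<Sum>n. (cmod (c n))\<^sup>2)" for n
    proof (rule sums_le[OF _ parseval_disc[OF sums exhaustion_radius] summable_sums[OF sc]])
      show "(cmod (c k))\<^sup>2 * exhaustion_radius n ^ (2 * k) \<le> (cmod (c k))\<^sup>2" for k
        using exhaustion_radius[of n] by (intro mult_left_le) (auto simp: power_le_one)
    qed
    then show "\<forall>\<^sub>F n in sequentially. (LINT \<xi>|circle_measure. (cmod (h (of_real (exhaustion_radius n) * \<xi>)))\<^sup>2)
        \<le> (\<Sum>n. (cmod (c n))\<^sup>2)" by simp
  qed simp
qed

section \<open>Composition of inner functions\<close>

text \<open>The quotient \<open>(f z - f 0) / z\<close> stays bounded: near the origin by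
  compactness, and for \<open>|z| > 1/2\<close> because the division costs at most a factor 2.
  Shifting the coefficients drives an induction on their index.\<close>

lemma hinf_backward_shift:
  assumes f: "hinf f" and sums: "\<And>z. z \<in> ball 0 1 \<Longrightarrow> (\<lambda>n. c n * z ^ n) sums f z"
  obtains q where "hinf q" "\<And>z. z \<in> ball 0 1 \<Longrightarrow> (\<lambda>n. c (Suc n) * z ^ n) sums q z"
    "\<And>z. z \<in> ball 0 1 \<Longrightarrow> f z = c 0 + z * q z"
proof
  define q where "q z = (\<Sum>n. c (Suc n) * z ^ n)" for z
  have sm: "summable (\<lambda>n. c n * z ^ n)" if "z \<in> ball 0 1" for z
    using sums[OF that] by (rule sums_summable)
  show q_sums: "(\<lambda>n. c (Suc n) * z ^ n) sums q z" if "z \<in> ball 0 1" for z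
    unfolding q_def by (intro summable_sums powser_split_head sm that)
  show f_eq: "f z = c 0 + z * q z" if "z \<in> ball 0 1" for z
    using powser_split_head(1)[OF sm[OF that]] sums_unique[OF sums[OF that]]
    by (simp add: q_def mult.commute)
  have qh: "q holomorphic_on ball 0 1"
    using q_sums by (intro power_series_holomorphic[where a = "\<lambda>n. c (Suc n)"]) simp
  obtain B where B: "\<And>z. z \<in> ball 0 1 \<Longrightarrow> cmod (f z) \<le> B"
    using f by (rule hinfE) (rule that)
  have "compact (q ` cball 0 (1/2))"
    by (intro compact_continuous_image continuous_on_subset[OF holomorphic_on_imp_continuous_on[OF qh]]) auto
  then have "bounded (q ` cball 0 (1/2))" by (rule compact_imp_bounded)
  then obtain B' where B': "\<forall>z\<in>cball 0 (1/2). cmod (q z) \<le> B'"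
    unfolding bounded_iff by blast
  show "hinf q"
  proof (rule hinfI[OF qh])
    fix z :: complex assume z: "z \<in> ball 0 1"
    show "cmod (q z) \<le> max B' (2 * (B + cmod (c 0)))"
    proof (cases "cmod z \<le> 1/2")
      case True
      then have "z \<in> cball 0 (1/2)" by simp
      then have "cmod (q z) \<le> B'" using B' by blast
      then show ?thesis by (rule max.coboundedI1)
    next
      case False
      have "z * q z = f z - c 0" using f_eq[OF z] by simp
      then have "cmod z * cmod (q z) = cmod (f z - c 0)" by (metis norm_mult)
      also have "\<dots> \<le> cmod (f z) + cmod (c 0)" by (rule norm_triangle_ineq4)
      also have "\<dots> \<le> B + cmod (c 0)" using B[OF z] by simp
      finally have *: "cmod z * cmod (q z) \<le> B + cmod (c 0)" .
      have "1/2 * cmod (q z) \<le> cmod z * cmod (q z)"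
        using False by (intro mult_right_mono) auto
      with * have "cmod (q z) \<le> 2 * (B + cmod (c 0))" by simp
      then show ?thesis by (rule max.coboundedI2)
    qed
  qed
qed

lemma inner_function_boundary_value:
  assumes "inner_function f"
  shows "AE \<xi> in circle_measure. cmod (boundary_value f \<xi>) = 1"
proof -
  have "AE \<xi> in circle_measure. \<exists>l. ((\<lambda>r::real. f (of_real r * \<xi>)) \<longlongrightarrow> l) (at_left 1) \<and> cmod l = 1"
    using assms by (simp add: inner_function_def)
  then show ?thesis by eventually_elim (use boundary_value_eqI(2) in blast)
qed

text \<open>With \<open>f z = c 0 + z * q z\<close>, one factor of the boundary value of
  \<open>g\<close> cancels against its conjugate, which lowers the exponent by one and replaces
  \<open>f\<close> by \<open>q\<close>. The constant term contributes the conjugate of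
  \<open>g(0)^(n + 1)\<close>, which is zero.\<close>

lemma composition_coefficient:
  assumes g: "g holomorphic_on ball 0 1" "g ` ball 0 1 \<subseteq> ball 0 1" "g 0 = 0"
    and g1: "AE \<xi> in circle_measure. cmod (boundary_value g \<xi>) = 1"
    and f: "hinf f" and sums: "\<And>z. z \<in> ball 0 1 \<Longrightarrow> (\<lambda>n. c n * z ^ n) sums f z"
  shows "(LINT \<xi>|circle_measure. boundary_value (\<lambda>z. f (g z)) \<xi> * cnj (boundary_value g \<xi> ^ n)) = c n"
  using f sums
proof (induction n arbitrary: f c)
  case 0
  have "(LINT \<xi>|circle_measure. boundary_value (\<lambda>z. f (g z)) \<xi>) = f (g 0)"
    using integral_boundary_value[OF hinf_compose[OF 0(1) g(1,2)]] by simp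
  also have "\<dots> = c 0"
    using 0(2)[of 0] g(3) by (simp add: powser_sums_zero_iff)
  finally show ?case by simp
next
  case (Suc n)
  note gh = hinf_self_map[OF g(1,2)]
  obtain q where q: "hinf q" "\<And>z. z \<in> ball 0 1 \<Longrightarrow> (\<lambda>n. c (Suc n) * z ^ n) sums q z"
    "\<And>z. z \<in> ball 0 1 \<Longrightarrow> f z = c 0 + z * q z"
    using hinf_backward_shift[OF Suc.prems] by blast
  note fgh = hinf_compose[OF Suc.prems(1) g(1,2)] and qgh = hinf_compose[OF q(1) g(1,2)]
  let ?bg = "boundary_value g" and ?bq = "boundary_value (\<lambda>z. q (g z))"
  have "AE \<xi> in circle_measure. boundary_value (\<lambda>z. f (g z)) \<xi> = boundary_value (\<lambda>z. c 0 + g z * q (g z)) \<xi>"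
    using q(3) g(2) by (intro AE_boundary_value_cong) blast
  moreover have "AE \<xi> in circle_measure. boundary_value (\<lambda>z. c 0 + g z * q (g z)) \<xi>
      = boundary_value (\<lambda>_. c 0) \<xi> + boundary_value (\<lambda>z. g z * q (g z)) \<xi>"
    by (intro AE_boundary_value_add hinf_intros gh qgh)
  moreover note AE_boundary_value_const[of "c 0"] AE_boundary_value_mult[OF gh qgh] g1
  ultimately have "AE \<xi> in circle_measure. boundary_value (\<lambda>z. f (g z)) \<xi> * cnj (?bg \<xi> ^ Suc n)
      = c 0 * cnj (?bg \<xi> ^ Suc n) + ?bq \<xi> * cnj (?bg \<xi> ^ n)"
  proof eventually_elim
    case (elim \<xi>)
    \<comment> \<open>This cancellation is where unimodularity of \<open>g\<close> on the circle is
      used.\<close>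
    have "?bg \<xi> * cnj (?bg \<xi>) = 1" using elim(5) by (rule cmod_eq_1_cnj)
    moreover have "?bg \<xi> * ?bq \<xi> * cnj (?bg \<xi> ^ Suc n) = (?bg \<xi> * cnj (?bg \<xi>)) * (?bq \<xi> * cnj (?bg \<xi> ^ n))"
      by (simp add: mult_ac)
    ultimately have "?bg \<xi> * ?bq \<xi> * cnj (?bg \<xi> ^ Suc n) = ?bq \<xi> * cnj (?bg \<xi> ^ n)"
      by (simp only: mult_1)
    then show ?case using elim(1-4) by (simp only: distrib_right)
  qed
  then have "(LINT \<xi>|circle_measure. boundary_value (\<lambda>z. f (g z)) \<xi> * cnj (?bg \<xi> ^ Suc n))
     = (LINT \<xi>|circle_measure. c 0 * cnj (?bg \<xi> ^ Suc n) + ?bq \<xi> * cnj (?bg \<xi> ^ n))"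
    by (intro integral_cong_AE)
      (auto intro!: ess_bounded_measurable ess_bounded_intros fgh gh qgh simp del: power_Suc complex_cnj_power)
  also have "\<dots> = (LINT \<xi>|circle_measure. c 0 * cnj (?bg \<xi> ^ Suc n))
      + (LINT \<xi>|circle_measure. ?bq \<xi> * cnj (?bg \<xi> ^ n))"
    by (intro Bochner_Integration.integral_add ess_bounded_integrable ess_bounded_intros gh qgh)
  also have "(LINT \<xi>|circle_measure. c 0 * cnj (?bg \<xi> ^ Suc n)) = c 0 * cnj (LINT \<xi>|circle_measure. ?bg \<xi> ^ Suc n)"
    by (simp only: Bochner_Integration.integral_cnj integral_mult_right_zero)
  also have "(LINT \<xi>|circle_measure. ?bg \<xi> ^ Suc n) = (LINT \<xi>|circle_measure. boundary_value (\<lambda>z. g z ^ Suc n) \<xi>)"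
  proof (rule integral_cong_AE)
    show "AE \<xi> in circle_measure. ?bg \<xi> ^ Suc n = boundary_value (\<lambda>z. g z ^ Suc n) \<xi>"
      using AE_boundary_value_power[OF gh, of "Suc n"] by eventually_elim (rule sym)
  qed (intro ess_bounded_measurable ess_bounded_intros hinf_intros gh)+
  also have "\<dots> = g 0 ^ Suc n"
    by (rule integral_boundary_value) (intro hinf_intros gh)
  also have "(LINT \<xi>|circle_measure. ?bq \<xi> * cnj (?bg \<xi> ^ n)) = c (Suc n)"
    using q by (intro Suc.IH) auto
  finally show ?case using g(3) by simp
qed

text \<open>The mean of \<open>|F - S|^2\<close> is nonnegative and expands to the difference of the
  two sides, where \<open>S\<close> is the orthogonal projection of \<open>F\<close>.\<close>

lemma bessel_inequality_circle:
  fixes u :: "nat \<Rightarrow> complex \<Rightarrow> complex"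
  assumes F: "ess_bounded F" and u: "\<And>n. ess_bounded (u n)"
    and ortho: "\<And>i j. (LINT \<xi>|circle_measure. u i \<xi> * cnj (u j \<xi>)) = (if i = j then 1 else 0)"
    and c: "\<And>n. (LINT \<xi>|circle_measure. F \<xi> * cnj (u n \<xi>)) = c n"
  shows "(\<Sum>n<N. (cmod (c n))\<^sup>2) \<le> (LINT \<xi>|circle_measure. (cmod (F \<xi>))\<^sup>2)"
proof -
  define S where "S \<xi> = (\<Sum>n<N. c n * u n \<xi>)" for \<xi>
  define \<Sigma> where "\<Sigma> = (\<Sum>n<N. (cmod (c n))\<^sup>2)"
  have Sb: "ess_bounded S" unfolding S_def by (intro ess_bounded_intros u)
  \<comment> \<open>\<open>F\<close> and \<open>S\<close> have the same first \<open>N\<close>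
    coefficients, so one computation yields both of their pairings with \<open>S\<close>.\<close>
  have pair: "(LINT \<xi>|circle_measure. G \<xi> * cnj (S \<xi>)) = of_real \<Sigma>"
    if G: "ess_bounded G" and Gc: "\<And>n. n < N \<Longrightarrow> (LINT \<xi>|circle_measure. G \<xi> * cnj (u n \<xi>)) = c n" for G
  proof -
    have "(LINT \<xi>|circle_measure. G \<xi> * cnj (S \<xi>)) = (LINT \<xi>|circle_measure. (\<Sum>n<N. cnj (c n) * (G \<xi> * cnj (u n \<xi>))))"
      by (simp add: S_def sum_distrib_left mult_ac)
    also have "\<dots> = (\<Sum>n<N. LINT \<xi>|circle_measure. cnj (c n) * (G \<xi> * cnj (u n \<xi>)))"
      by (intro Bochner_Integration.integral_sum ess_bounded_integrable ess_bounded_intros G u)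
    also have "\<dots> = (\<Sum>n<N. cnj (c n) * c n)"
      by (intro sum.cong) (simp_all add: Gc)
    also have "\<dots> = of_real \<Sigma>"
      unfolding \<Sigma>_def of_real_sum complex_norm_square by (simp add: mult.commute)
    finally show ?thesis .
  qed
  have FS: "(LINT \<xi>|circle_measure. F \<xi> * cnj (S \<xi>)) = of_real \<Sigma>"
    by (intro pair F c)
  have SS: "(LINT \<xi>|circle_measure. S \<xi> * cnj (S \<xi>)) = of_real \<Sigma>"
  proof (rule pair[OF Sb])
    fix m assume "m < N"
    have "(LINT \<xi>|circle_measure. S \<xi> * cnj (u m \<xi>)) = (LINT \<xi>|circle_measure. (\<Sum>n<N. c n * (u n \<xi> * cnj (u m \<xi>))))"
      by (simp add: S_def sum_distrib_right mult.assoc)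
    also have "\<dots> = (\<Sum>n<N. LINT \<xi>|circle_measure. c n * (u n \<xi> * cnj (u m \<xi>)))"
      by (intro Bochner_Integration.integral_sum ess_bounded_integrable ess_bounded_intros u)
    also have "\<dots> = (\<Sum>n<N. if n = m then c n else 0)"
      by (intro sum.cong) (simp_all add: ortho)
    also have "\<dots> = c m"
      using \<open>m < N\<close> by simp
    finally show "(LINT \<xi>|circle_measure. S \<xi> * cnj (u m \<xi>)) = c m" .
  qed
  have sq: "(LINT \<xi>|circle_measure. G \<xi> * cnj (G \<xi>)) = of_real (LINT \<xi>|circle_measure. (cmod (G \<xi>))\<^sup>2)" for G
    unfolding complex_norm_square[symmetric] by (rule integral_complex_of_real)
  have "of_real (LINT \<xi>|circle_measure. (cmod (F \<xi> - S \<xi>))\<^sup>2)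
      = (LINT \<xi>|circle_measure. (F \<xi> * cnj (F \<xi>) - F \<xi> * cnj (S \<xi>)) + (S \<xi> * cnj (S \<xi>) - cnj (F \<xi> * cnj (S \<xi>))))"
    unfolding sq[symmetric] by (simp add: algebra_simps)
  also have "\<dots> = ((LINT \<xi>|circle_measure. F \<xi> * cnj (F \<xi>)) - (LINT \<xi>|circle_measure. F \<xi> * cnj (S \<xi>)))
       + ((LINT \<xi>|circle_measure. S \<xi> * cnj (S \<xi>)) - (LINT \<xi>|circle_measure. cnj (F \<xi> * cnj (S \<xi>))))"
    by (subst Bochner_Integration.integral_add Bochner_Integration.integral_diff;
        (intro ess_bounded_integrable ess_bounded_intros F Sb)?)+ simp
  also have "\<dots> = of_real (LINT \<xi>|circle_measure. (cmod (F \<xi>))\<^sup>2) - of_real \<Sigma>"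
    unfolding Bochner_Integration.integral_cnj sq FS SS[unfolded sq] by simp
  finally have "(LINT \<xi>|circle_measure. (cmod (F \<xi> - S \<xi>))\<^sup>2) = (LINT \<xi>|circle_measure. (cmod (F \<xi>))\<^sup>2) - \<Sigma>"
    by (simp only: of_real_eq_iff flip: of_real_diff)
  moreover have "0 \<le> (LINT \<xi>|circle_measure. (cmod (F \<xi> - S \<xi>))\<^sup>2)"
    by (rule Bochner_Integration.integral_nonneg) simp
  ultimately show ?thesis by (simp add: \<Sigma>_def)
qed

text \<open>Radial limits of \<open>f\<close> give no direct control along the image curves
  \<open>g(r * \<xi>)\<close>, which need not be radial. The argument goes through norms instead: 1
  is at most the coefficient sum of \<open>f\<close>, which is at most the square mean of
  \<open>f \<circ> g\<close>, and the latter has modulus at most 1.\<close>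

lemma inner_compose:
  assumes f: "f holomorphic_on ball 0 1" "f ` ball 0 1 \<subseteq> ball 0 1"
    and f1: "AE \<xi> in circle_measure. cmod (boundary_value f \<xi>) = 1"
    and g: "g holomorphic_on ball 0 1" "g ` ball 0 1 \<subseteq> ball 0 1" "g 0 = 0"
    and g1: "AE \<xi> in circle_measure. cmod (boundary_value g \<xi>) = 1"
  shows "AE \<xi> in circle_measure. cmod (boundary_value (\<lambda>z. f (g z)) \<xi>) = 1"
proof -
  define c where "c n = (deriv ^^ n) f 0 / fact n" for n
  have sums: "(\<lambda>n. c n * z ^ n) sums f z" if "z \<in> ball 0 1" for z
    using holomorphic_power_series[OF f(1) that] by (simp add: c_def)
  note fh = hinf_self_map[OF f] and gh = hinf_self_map[OF g(1,2)]
  note fgh = hinf_compose[OF fh g(1,2)]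
  let ?b = "boundary_value (\<lambda>z. f (g z))"
  have ortho: "(LINT \<xi>|circle_measure. boundary_value g \<xi> ^ i * cnj (boundary_value g \<xi> ^ j)) = (if i = j then 1 else 0)"
    for i j
  proof -
    have "(LINT \<xi>|circle_measure. boundary_value (\<lambda>z. g z ^ i) \<xi> * cnj (boundary_value g \<xi> ^ j))
        = (if j = i then 1 else 0)"
    \<comment> \<open>The monomial \<open>z ^ i\<close> has a single nonzero Taylor coefficient, so
      the coefficient formula applied to it is exactly orthonormality.\<close>
    proof (rule composition_coefficient[OF g g1, where f = "\<lambda>z. z ^ i"])
      show "(\<lambda>n. (if n = i then 1 else 0) * z ^ n) sums z ^ i" for z :: complex
        using sums_single[of i "\<lambda>n. z ^ n"] by (simp add: if_distrib[of "\<lambda>x. x * _"] cong: if_cong)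
    qed (intro hinf_intros)
    moreover have "(LINT \<xi>|circle_measure. boundary_value (\<lambda>z. g z ^ i) \<xi> * cnj (boundary_value g \<xi> ^ j))
       = (LINT \<xi>|circle_measure. boundary_value g \<xi> ^ i * cnj (boundary_value g \<xi> ^ j))"
    proof (rule integral_cong_AE)
      show "AE \<xi> in circle_measure. boundary_value (\<lambda>z. g z ^ i) \<xi> * cnj (boundary_value g \<xi> ^ j)
          = boundary_value g \<xi> ^ i * cnj (boundary_value g \<xi> ^ j)"
        using AE_boundary_value_power[OF gh, of i] by eventually_elim simp
    qed (intro ess_bounded_measurable ess_bounded_intros hinf_intros gh)+
    ultimately show ?thesis by auto
  qed
  have "AE \<xi> in circle_measure. (cmod (boundary_value f \<xi>))\<^sup>2 = 1"
    using f1 by eventually_elim simp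
  then have "(LINT \<xi>|circle_measure. (cmod (boundary_value f \<xi>))\<^sup>2) = (LINT \<xi>|circle_measure. 1)"
    using measurable_boundary_value[OF fh] by (intro integral_cong_AE) auto
  then have "1 = (LINT \<xi>|circle_measure. (cmod (boundary_value f \<xi>))\<^sup>2)"
    by (simp add: circle.prob_space del: space_circle_measure)
  also have "\<dots> \<le> (\<Sum>n. (cmod (c n))\<^sup>2)"
    by (rule integral_norm_square_boundary_value_le(2)[OF fh sums])
  also have "\<dots> \<le> (LINT \<xi>|circle_measure. (cmod (?b \<xi>))\<^sup>2)"
    by (intro suminf_le_const integral_norm_square_boundary_value_le(1)[OF fh sums]
        bessel_inequality_circle[OF _ _ ortho] composition_coefficient[OF g g1 fh sums] ess_bounded_intros fgh gh)
  finally have ge: "1 \<le> (LINT \<xi>|circle_measure. (cmod (?b \<xi>))\<^sup>2)" .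
  have le: "AE \<xi> in circle_measure. cmod (?b \<xi>) \<le> 1"
    using f(2) g(2) by (intro AE_boundary_value_le fgh) fastforce
  have sqi: "integrable circle_measure (\<lambda>\<xi>. (cmod (?b \<xi>))\<^sup>2)"
  proof (rule circle.integrable_const_bound[where B = 1])
    show "AE \<xi> in circle_measure. norm ((cmod (?b \<xi>))\<^sup>2) \<le> 1"
      using le by eventually_elim (simp add: power_le_one)
  qed (use measurable_boundary_value[OF fgh] in auto)
  \<comment> \<open>The deficit \<open>1 - |f \<circ> g|^2\<close> is nonnegative almost everywhere
    with mean zero, hence it vanishes almost everywhere.\<close>
  have "(LINT \<xi>|circle_measure. 1 - (cmod (?b \<xi>))\<^sup>2) = 1 - (LINT \<xi>|circle_measure. (cmod (?b \<xi>))\<^sup>2)"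
    using sqi by (simp add: circle.prob_space del: space_circle_measure)
  moreover have nn: "AE \<xi> in circle_measure. 0 \<le> 1 - (cmod (?b \<xi>))\<^sup>2"
    using le by eventually_elim (simp add: power_le_one)
  then have "0 \<le> (LINT \<xi>|circle_measure. 1 - (cmod (?b \<xi>))\<^sup>2)" by (rule integral_nonneg_AE)
  ultimately have "(LINT \<xi>|circle_measure. 1 - (cmod (?b \<xi>))\<^sup>2) = 0" using ge by linarith
  then have "AE \<xi> in circle_measure. 1 - (cmod (?b \<xi>))\<^sup>2 = 0"
    using sqi by (subst (asm) integral_nonneg_eq_0_iff_AE[OF _ nn]) auto
  then show ?thesis by eventually_elim (rule power2_eq_imp_eq; simp)
qed

section \<open>Contraction along the iterates\<close>

lemma pseudohyperbolic_identity:
  "(cmod (1 - cnj a * b))\<^sup>2 - (cmod (b - a))\<^sup>2 = (1 - (cmod a)\<^sup>2) * (1 - (cmod b)\<^sup>2)"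
proof -
  have "complex_of_real ((cmod (1 - cnj a * b))\<^sup>2 - (cmod (b - a))\<^sup>2)
      = complex_of_real ((1 - (cmod a)\<^sup>2) * (1 - (cmod b)\<^sup>2))"
    unfolding of_real_diff of_real_mult of_real_1 complex_norm_square by (simp add: algebra_simps)
  then show ?thesis by (simp only: of_real_eq_iff)
qed

text \<open>Schwarz's lemma applies to \<open>\<phi>\<close>, which is \<open>g\<close> followed by
  the disc automorphism sending \<open>g 0\<close> to 0. The pseudohyperbolic identity converts
  \<open>|\<phi> z| \<le> |z|\<close> into a bound on \<open>1 - |g z|^2\<close>, and a factor
  \<open>1 - \<alpha>\<close> cancels.\<close>

lemma schwarz_pick_lower_bound:
  assumes g: "g holomorphic_on ball 0 1" and g1: "\<And>z. z \<in> ball 0 1 \<Longrightarrow> cmod (g z) < 1"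
    and z: "z \<in> ball 0 1"
  shows "(1 - cmod (g 0)) * (1 - (cmod z)\<^sup>2) \<le> (1 + cmod (g 0)) * (1 - (cmod (g z))\<^sup>2)"
proof -
  define a where "a = g 0"
  define \<alpha> where "\<alpha> = cmod a"
  have \<alpha>: "0 \<le> \<alpha>" "\<alpha> < 1" using g1[of 0] by (auto simp: \<alpha>_def a_def)
  define \<phi> where "\<phi> w = (g w - a) / (1 - cnj a * g w)" for w
  have low: "1 - \<alpha> \<le> cmod (1 - cnj a * g w)" if "w \<in> ball 0 1" for w
  proof -
    have "cmod (cnj a * g w) \<le> \<alpha> * 1"
      unfolding norm_mult \<alpha>_def complex_mod_cnj using g1[OF that] by (intro mult_left_mono) auto
    then show ?thesis using norm_triangle_ineq2[of 1 "cnj a * g w"] by simp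
  qed
  have nz: "1 - cnj a * g w \<noteq> 0" if "w \<in> ball 0 1" for w
    using low[OF that] \<alpha> by auto
  have "\<phi> holomorphic_on ball 0 1"
    unfolding \<phi>_def using nz by (intro holomorphic_intros g) auto
  moreover have "\<phi> 0 = 0" by (simp add: \<phi>_def a_def)
  moreover have "cmod (\<phi> w) < 1" if "cmod w < 1" for w
  proof -
    have w: "w \<in> ball 0 1" using that by simp
    have "0 < (1 - (cmod a)\<^sup>2) * (1 - (cmod (g w))\<^sup>2)"
      using g1[OF w] \<alpha> by (intro mult_pos_pos) (simp_all add: \<alpha>_def abs_square_less_1)
    then have "(cmod (g w - a))\<^sup>2 < (cmod (1 - cnj a * g w))\<^sup>2"
      using pseudohyperbolic_identity[of a "g w"] by linarith
    then have "cmod (g w - a) < cmod (1 - cnj a * g w)"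
      by (rule power2_less_imp_less) simp
    then show ?thesis using nz[OF w] by (simp add: \<phi>_def norm_divide)
  qed
  ultimately have "cmod (\<phi> z) \<le> cmod z"
    using z by (intro Schwarz_Lemma(1)) auto
  then have "cmod (g z - a) \<le> cmod z * cmod (1 - cnj a * g z)"
    using nz[OF z] by (simp add: \<phi>_def norm_divide divide_simps)
  then have "(cmod (g z - a))\<^sup>2 \<le> (cmod z)\<^sup>2 * (cmod (1 - cnj a * g z))\<^sup>2"
    using power_mono[of _ "cmod z * cmod (1 - cnj a * g z)" 2] by (simp add: power_mult_distrib)
  then have "(1 - (cmod z)\<^sup>2) * (cmod (1 - cnj a * g z))\<^sup>2 \<le> (1 - \<alpha>\<^sup>2) * (1 - (cmod (g z))\<^sup>2)"
    using pseudohyperbolic_identity[of a "g z"] unfolding \<alpha>_def by (simp add: algebra_simps)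
  moreover have "(1 - (cmod z)\<^sup>2) * (1 - \<alpha>)\<^sup>2 \<le> (1 - (cmod z)\<^sup>2) * (cmod (1 - cnj a * g z))\<^sup>2"
    using z \<alpha> low[OF z] by (intro mult_left_mono power_mono) (auto simp: abs_square_le_1)
  moreover have "(1 - \<alpha>\<^sup>2) = (1 - \<alpha>) * (1 + \<alpha>)" by (simp add: power2_eq_square algebra_simps)
  ultimately have "(1 - \<alpha>) * ((1 - \<alpha>) * (1 - (cmod z)\<^sup>2)) \<le> (1 - \<alpha>) * ((1 + \<alpha>) * (1 - (cmod (g z))\<^sup>2))"
    by (simp only: power2_eq_square mult_ac)
  then show ?thesis using \<alpha> by (simp add: \<alpha>_def a_def)
qed

text \<open>\<open>g\<close> is \<open>f z / z\<close> with the removable singularity filled by the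
  derivative. Not being a rotation makes \<open>|g| < 1\<close> strictly, and Schwarz-Pick turns
  \<open>|g 0| < 1\<close> into a contraction factor valid on the whole disc.\<close>

lemma non_rotation_factor:
  assumes f: "f holomorphic_on ball 0 1" "f ` ball 0 1 \<subseteq> ball 0 1" "f 0 = 0" and rot: "\<not> is_rotation f"
  obtains g q where "g holomorphic_on ball 0 1" "0 \<le> q" "q < (1::real)"
    "\<And>z. z \<in> ball 0 1 \<Longrightarrow> f z = z * g z"
    "\<And>z. z \<in> ball 0 1 \<Longrightarrow> cmod (g z) \<le> 1"
    "\<And>z. z \<in> ball 0 1 \<Longrightarrow> (1 - (cmod z)\<^sup>2) * (cmod (g z))\<^sup>2 \<le> q * (1 - (cmod (f z))\<^sup>2)"
proof -
  define g where "g z = (if z = 0 then deriv f 0 else f z / z)" for z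
  define \<alpha> where "\<alpha> = cmod (g 0)"
  have gh: "g holomorphic_on ball 0 1"
    by (rule pole_theorem_open_0[OF f(1), of 0]) (auto simp: g_def f(3))
  have fz: "f z = z * g z" for z by (simp add: g_def f(3))
  have f1: "cmod (f z) < 1" if "cmod z < 1" for z using f(2) that by force
  note SL = Schwarz_Lemma[OF f(1,3) f1]
  have strict: "cmod (g z) < 1" if z: "z \<in> ball 0 1" for z
  proof (rule ccontr)
    assume ge: "\<not> cmod (g z) < 1"
    \<comment> \<open>These are the two equality cases of Schwarz's lemma, at an interior point or
      for the derivative at the origin; either one makes \<open>f\<close> a rotation.\<close>
    have "(\<exists>z. cmod z < 1 \<and> z \<noteq> 0 \<and> cmod (f z) = cmod z) \<or> cmod (deriv f 0) = 1"
    proof (cases "z = 0")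
      case True
      then show ?thesis using ge SL(2)[of 0] by (simp add: g_def)
    next
      case False
      have "cmod z * 1 \<le> cmod z * cmod (g z)" using ge by (intro mult_left_mono) auto
      then have "cmod (f z) = cmod z" using SL(1)[of z] z by (simp add: fz[of z] norm_mult)
      then show ?thesis using False z by auto
    qed
    then have "\<exists>c. (\<forall>z. cmod z < 1 \<longrightarrow> f z = c * z) \<and> cmod c = 1"
      by (intro SL(3)[of 0]) auto
    then show False using rot by (auto simp: is_rotation_def)
  qed
  have \<alpha>: "0 \<le> \<alpha>" "\<alpha> < 1" using strict[of 0] by (auto simp: \<alpha>_def)
  show ?thesis
  proof
    show "0 \<le> (1 + \<alpha>) / 2" "(1 + \<alpha>) / 2 < 1" using \<alpha> by auto
    show "cmod (g z) \<le> 1" if "z \<in> ball 0 1" for z using strict[OF that] by simp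
    fix z :: complex assume z: "z \<in> ball 0 1"
    define s t where "s = (cmod (g z))\<^sup>2" and "t = (cmod z)\<^sup>2"
    have st: "0 \<le> s" "s \<le> 1" "0 \<le> t" "t \<le> 1"
      using strict[OF z] z by (auto simp: s_def t_def abs_square_le_1)
    have ft: "(cmod (f z))\<^sup>2 = t * s"
      by (simp add: fz[of z] norm_mult power_mult_distrib s_def t_def)
    have "(1 - \<alpha>) * (1 - t) * s \<le> (1 - \<alpha>) * (1 - t) * 1"
      using \<alpha> st by (intro mult_left_mono) auto
    also have "\<dots> \<le> (1 + \<alpha>) * (1 - s)"
      using schwarz_pick_lower_bound[OF gh strict z] by (simp add: \<alpha>_def s_def t_def)
    \<comment> \<open>Adding \<open>(1 + \<alpha>) * (1 - t) * s\<close> to both sides gives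
      \<open>2 * (1 - t) * s\<close> on the left and \<open>(1 + \<alpha>) * (1 - t * s)\<close> on
      the right, which explains the factor \<open>(1 + \<alpha>) / 2\<close>.\<close>
    finally have "(1 - t) * s \<le> (1 + \<alpha>) / 2 * (1 - t * s)"
      by (simp add: field_simps)
    then show "(1 - (cmod z)\<^sup>2) * (cmod (g z))\<^sup>2 \<le> (1 + \<alpha>) / 2 * (1 - (cmod (f z))\<^sup>2)"
      unfolding ft by (simp add: s_def t_def)
  qed (use gh fz in auto)
qed

section \<open>Schur test for a geometrically decaying kernel\<close>

lemma sum_power_inj_le:
  fixes q :: real
  assumes "finite A" "inj_on e A" "0 \<le> q" "q < 1"
  shows "(\<Sum>k\<in>A. q ^ e k) \<le> 1 / (1 - q)"
proof -
  have "(\<Sum>k\<in>A. q ^ e k) = (\<Sum>j\<in>e ` A. q ^ j)"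
    using assms(2) by (simp add: sum.reindex)
  also have "\<dots> \<le> (\<Sum>j. q ^ j)"
    using assms by (intro sum_le_suminf summable_geometric) auto
  also have "\<dots> = 1 / (1 - q)"
    using assms by (intro suminf_geometric) auto
  finally show ?thesis .
qed

text \<open>With truncated subtraction \<open>(n - k) + (k - n)\<close> is the distance of
  \<open>n\<close> and \<open>k\<close>. Each row splits at the diagonal into two parts of a
  geometric series; symmetry and the inequality between \<open>x n * x k\<close> and the mean of the
  squares do the rest.\<close>

lemma schur_test_geometric:
  fixes q :: real and x :: "nat \<Rightarrow> real"
  assumes A: "finite A" and q: "0 \<le> q" "q < 1"
  shows "(\<Sum>n\<in>A. \<Sum>k\<in>A. q ^ ((n - k) + (k - n)) * (x n * x k)) \<le> 2 / (1 - q) * (\<Sum>n\<in>A. (x n)\<^sup>2)"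
proof -
  define w where "w n k = q ^ ((n - k) + (k - n))" for n k :: nat
  have row: "(\<Sum>k\<in>A. w n k) \<le> 2 / (1 - q)" for n
  proof -
    have "(\<Sum>k\<in>A. w n k) = (\<Sum>k\<in>A \<inter> {..n}. w n k) + (\<Sum>k\<in>A - {..n}. w n k)"
      using A by (rule sum.Int_Diff)
    also have "(\<Sum>k\<in>A \<inter> {..n}. w n k) = (\<Sum>k\<in>A \<inter> {..n}. q ^ (n - k))"
      by (intro sum.cong) (auto simp: w_def)
    also have "\<dots> \<le> 1 / (1 - q)"
      using A q by (intro sum_power_inj_le) (auto simp: inj_on_def)
    also have "(\<Sum>k\<in>A - {..n}. w n k) = (\<Sum>k\<in>A - {..n}. q ^ (k - n))"
      by (intro sum.cong) (auto simp: w_def)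
    also have "\<dots> \<le> 1 / (1 - q)"
      using A q by (intro sum_power_inj_le) (auto simp: inj_on_def)
    finally show ?thesis by simp
  qed
  have w0: "0 \<le> w n k" for n k using q by (simp add: w_def)
  have sym: "w n k = w k n" for n k by (simp add: w_def add.commute)
  have "(\<Sum>n\<in>A. \<Sum>k\<in>A. w n k * (x n * x k)) \<le> (\<Sum>n\<in>A. \<Sum>k\<in>A. w n k * (x n)\<^sup>2 / 2 + w n k * (x k)\<^sup>2 / 2)"
  proof (intro sum_mono)
    fix n k
    have "x n * x k \<le> ((x n)\<^sup>2 + (x k)\<^sup>2) / 2"
      using sum_squares_bound[of "x n" "x k"] by simp
    then have "w n k * (x n * x k) \<le> w n k * (((x n)\<^sup>2 + (x k)\<^sup>2) / 2)"
      by (intro mult_left_mono w0)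
    then show "w n k * (x n * x k) \<le> w n k * (x n)\<^sup>2 / 2 + w n k * (x k)\<^sup>2 / 2"
      by (simp add: field_simps)
  qed
  also have "\<dots> = (\<Sum>n\<in>A. \<Sum>k\<in>A. w n k * (x n)\<^sup>2 / 2) + (\<Sum>n\<in>A. \<Sum>k\<in>A. w n k * (x k)\<^sup>2 / 2)"
    by (simp add: sum.distrib)
  also have "(\<Sum>n\<in>A. \<Sum>k\<in>A. w n k * (x k)\<^sup>2 / 2) = (\<Sum>n\<in>A. \<Sum>k\<in>A. w n k * (x n)\<^sup>2 / 2)"
    by (subst sum.swap) (simp add: sym)
  also have "(\<Sum>n\<in>A. \<Sum>k\<in>A. w n k * (x n)\<^sup>2 / 2) + (\<Sum>n\<in>A. \<Sum>k\<in>A. w n k * (x n)\<^sup>2 / 2)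
      = (\<Sum>n\<in>A. (\<Sum>k\<in>A. w n k) * (x n)\<^sup>2)"
    by (simp add: sum_distrib_right flip: sum.distrib)
  also have "\<dots> \<le> (\<Sum>n\<in>A. 2 / (1 - q) * (x n)\<^sup>2)"
    by (intro sum_mono mult_right_mono row) auto
  also have "\<dots> = 2 / (1 - q) * (\<Sum>n\<in>A. (x n)\<^sup>2)"
    by (simp add: sum_distrib_left)
  finally show ?thesis unfolding w_def .
qed

section \<open>Iterates: innerness and factorisation along an orbit\<close>

lemma funpow_disc:
  assumes "f holomorphic_on ball 0 1" "f ` ball 0 1 \<subseteq> ball 0 1"
  shows "(f ^^ n) holomorphic_on ball 0 1 \<and> (f ^^ n) ` ball 0 1 \<subseteq> ball 0 1"
proof (induction n)
  case 0
  show ?case by (auto simp: id_def intro: holomorphic_intros)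
next
  case (Suc n)
  then have "(f \<circ> f ^^ n) holomorphic_on ball 0 1" "f ` (f ^^ n) ` ball 0 1 \<subseteq> ball 0 1"
    using assms(2) by (blast intro: holomorphic_on_compose_gen[OF _ assms(1)])+
  then show ?case unfolding funpow.simps image_comp[symmetric] by blast
qed

text \<open>The induction keeps \<open>f\<close> as the outer map and the iterate as the inner one;
  the iterate fixes the origin, as \<open>inner_compose\<close> requires.\<close>

lemma inner_funpow:
  assumes f: "inner_function f" and f0: "f 0 = 0"
  shows "AE \<xi> in circle_measure. cmod (boundary_value (f ^^ n) \<xi>) = 1"
proof (induction n)
  case 0
  show ?case
    using AE_boundary_value_ident AE_space by eventually_elim (simp add: id_def)
next
  case (Suc n)
  have fd: "f holomorphic_on ball 0 1" "f ` ball 0 1 \<subseteq> ball 0 1" using f by (auto simp: inner_function_def)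
  have "(f ^^ n) 0 = 0" by (induction n) (auto simp: f0)
  then have "AE \<xi> in circle_measure. cmod (boundary_value (\<lambda>z. f ((f ^^ n) z)) \<xi>) = 1"
    using funpow_disc[OF fd, of n]
    by (intro inner_compose[OF fd inner_function_boundary_value[OF f] _ _ _ Suc]) simp_all
  moreover have "f ^^ Suc n = (\<lambda>z. f ((f ^^ n) z))" by (simp add: fun_eq_iff)
  ultimately show ?case by (simp only:)
qed

lemma hinf_prod [hinf_intros]:
  "(\<And>i. i \<in> I \<Longrightarrow> hinf (h i)) \<Longrightarrow> hinf (\<lambda>z. \<Prod>i\<in>I. h i z)"
  by (induction I rule: infinite_finite_induct) (auto intro!: hinf_intros)

text \<open>Both claims telescope. In the second, each step trades \<open>1 - |w|^2\<close> together
  with a factor \<open>|g w|^2\<close> for \<open>q\<close> times \<open>1 - |f w|^2\<close>, where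
  \<open>w\<close> is the current point of the orbit.\<close>

lemma funpow_factor:
  assumes f: "f ` ball 0 1 \<subseteq> ball 0 1" and q: "0 \<le> q"
    and fg: "\<And>z. z \<in> ball 0 1 \<Longrightarrow> f z = z * g z"
    and gq: "\<And>z. z \<in> ball 0 1 \<Longrightarrow> (1 - (cmod z)\<^sup>2) * (cmod (g z))\<^sup>2 \<le> q * (1 - (cmod (f z))\<^sup>2)"
    and z: "z \<in> ball 0 1" and kn: "k \<le> n"
  shows "(f ^^ n) z = (f ^^ k) z * (\<Prod>i=k..<n. g ((f ^^ i) z))"
    and "(1 - (cmod ((f ^^ k) z))\<^sup>2) * (cmod (\<Prod>i=k..<n. g ((f ^^ i) z)))\<^sup>2 \<le> q ^ (n - k) * (1 - (cmod ((f ^^ n) z))\<^sup>2)"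
proof -
  have mem: "(f ^^ i) z \<in> ball 0 1" for i
  proof (induction i)
    case (Suc i)
    then have "f ((f ^^ i) z) \<in> f ` ball 0 1" by (rule imageI)
    then have "f ((f ^^ i) z) \<in> ball 0 1" by (rule subsetD[OF f])
    then show ?case by simp
  qed (use z in simp)
  show "(f ^^ n) z = (f ^^ k) z * (\<Prod>i=k..<n. g ((f ^^ i) z))"
    using kn
  proof (induction n rule: dec_induct)
    case (step n)
    have "(f ^^ Suc n) z = (f ^^ n) z * g ((f ^^ n) z)" using fg[OF mem] by simp
    also have "\<dots> = (f ^^ k) z * (\<Prod>i=k..<n. g ((f ^^ i) z)) * g ((f ^^ n) z)"
      by (rule arg_cong2[OF step.IH refl])
    finally show ?case using step.hyps by (simp only: prod.atLeastLessThan_Suc mult.assoc)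
  qed simp
  show "(1 - (cmod ((f ^^ k) z))\<^sup>2) * (cmod (\<Prod>i=k..<n. g ((f ^^ i) z)))\<^sup>2 \<le> q ^ (n - k) * (1 - (cmod ((f ^^ n) z))\<^sup>2)"
    using kn
  proof (induction n rule: dec_induct)
    case (step n)
    let ?B = "\<lambda>n. 1 - (cmod ((f ^^ n) z))\<^sup>2" and ?H = "\<Prod>i=k..<n. g ((f ^^ i) z)"
    have "?B k * (cmod (\<Prod>i=k..<Suc n. g ((f ^^ i) z)))\<^sup>2 = (?B k * (cmod ?H)\<^sup>2) * (cmod (g ((f ^^ n) z)))\<^sup>2"
      using step by (simp add: norm_mult power_mult_distrib)
    also have "\<dots> \<le> (q ^ (n - k) * ?B n) * (cmod (g ((f ^^ n) z)))\<^sup>2"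
      by (intro mult_right_mono step) auto
    also have "\<dots> \<le> q ^ (n - k) * (q * ?B (Suc n))"
      using gq[OF mem] q by (simp add: mult.assoc mult_left_mono)
    also have "\<dots> = q ^ (Suc n - k) * ?B (Suc n)"
      using step by (simp add: Suc_diff_le)
    finally show ?case .
  qed simp
qed

text \<open>The correlation of two iterates factors because \<^term>\<open>boundary_value F\<close> is unimodular: there
  \<^term>\<open>F * H\<close> times the conjugate of \<^term>\<open>F\<close> is \<^term>\<open>H\<close>.\<close>

lemma correlation_inner_multiple:
  fixes F G H :: "complex \<Rightarrow> complex"
  assumes F: "hinf F" "AE \<xi> in circle_measure. cmod (boundary_value F \<xi>) = 1"
    and H: "hinf H" and G: "hinf G" "\<And>z. z \<in> ball 0 1 \<Longrightarrow> G z = F z * H z" and z: "z \<in> ball 0 1"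
  shows "(LINT \<xi>|circle_measure. (boundary_value G \<xi> - G z) * cnj (boundary_value F \<xi> - F z) * poisson_kernel z \<xi>)
     = (1 - (cmod (F z))\<^sup>2) * H z"
proof -
  let ?P = "\<lambda>\<xi>. complex_of_real (poisson_kernel z \<xi>)"
  let ?f = "boundary_value F" and ?g = "boundary_value G" and ?h = "boundary_value H"
  note eb = ess_bounded_intros F(1) H G(1) z
  have "AE \<xi> in circle_measure. ?g \<xi> = boundary_value (\<lambda>z. F z * H z) \<xi>"
    using G(2) by (rule AE_boundary_value_cong)
  with AE_boundary_value_mult[OF F(1) H] F(2)
  have "AE \<xi> in circle_measure. (?g \<xi> - G z) * cnj (?f \<xi> - F z) * ?P \<xi>
      = (?h \<xi> * ?P \<xi> - cnj (F z) * (?g \<xi> * ?P \<xi>)) + (G z * cnj (F z) * ?P \<xi> - G z * cnj (?f \<xi> * ?P \<xi>))"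
  proof eventually_elim
    case (elim \<xi>)
    have "?f \<xi> * cnj (?f \<xi>) = 1" using elim(2) by (rule cmod_eq_1_cnj)
    then have "?g \<xi> * cnj (?f \<xi>) = ?h \<xi>"
      unfolding elim(3) elim(1) by (metis mult.commute mult.left_commute mult_1)
    then show ?case by (simp add: algebra_simps)
  qed
  then have "(LINT \<xi>|circle_measure. (?g \<xi> - G z) * cnj (?f \<xi> - F z) * ?P \<xi>)
      = (LINT \<xi>|circle_measure. (?h \<xi> * ?P \<xi> - cnj (F z) * (?g \<xi> * ?P \<xi>))
          + (G z * cnj (F z) * ?P \<xi> - G z * cnj (?f \<xi> * ?P \<xi>)))"
    by (intro integral_cong_AE ess_bounded_measurable eb)
  also have "\<dots> = ((LINT \<xi>|circle_measure. ?h \<xi> * ?P \<xi>) - (LINT \<xi>|circle_measure. cnj (F z) * (?g \<xi> * ?P \<xi>)))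
      + ((LINT \<xi>|circle_measure. G z * cnj (F z) * ?P \<xi>) - (LINT \<xi>|circle_measure. G z * cnj (?f \<xi> * ?P \<xi>)))"
    by (subst Bochner_Integration.integral_add Bochner_Integration.integral_diff;
        (intro ess_bounded_integrable eb)?)+ simp
  also have "\<dots> = (H z - cnj (F z) * G z) + (G z * cnj (F z) - G z * cnj (F z))"
    using z by (simp only: integral_mult_right_zero Bochner_Integration.integral_cnj
        poisson_formula_boundary_value F H G(1) integral_complex_of_real integral_poisson_kernel
        of_real_1 mult_1_right)
  also have "\<dots> = (1 - F z * cnj (F z)) * H z"
    using G(2)[OF z] by (simp add: algebra_simps)
  also have "\<dots> = (1 - (cmod (F z))\<^sup>2) * H z"
    by (simp add: complex_norm_square flip: of_real_power)
  finally show ?thesis .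
qed

section \<open>Bounding the quadratic form of the correlations\<close>

theorem theorem1p2:
  fixes f :: "complex \<Rightarrow> complex"
  assumes "inner_function f" and "f 0 = 0" and "\<not> is_rotation f"
  shows "\<exists>C::real. C > 0 \<and>
    (\<forall>N::nat. \<forall>a::nat \<Rightarrow> complex. \<forall>z\<in>ball 0 1. N \<ge> 1 \<longrightarrow>
       (\<integral>\<^sup>+ \<xi>. ennreal ((cmod (\<Sum>n=1..N. a n * (radial_limit (f ^^ n) \<xi> - (f ^^ n) z)))\<^sup>2
                      * poisson_kernel z \<xi>) \<partial>circle_measure)
       \<le> ennreal (C * (\<Sum>n=1..N. (cmod (a n))\<^sup>2 * (1 - (cmod ((f ^^ n) z))\<^sup>2))))"
proof -
  have fd: "f holomorphic_on ball 0 1" "f ` ball 0 1 \<subseteq> ball 0 1"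
    using assms(1) by (auto simp: inner_function_def)
  obtain g q2 where g: "g holomorphic_on ball 0 1" and q2: "0 \<le> q2" "q2 < (1::real)"
    and fg: "\<And>z. z \<in> ball 0 1 \<Longrightarrow> f z = z * g z"
    and g1: "\<And>z. z \<in> ball 0 1 \<Longrightarrow> cmod (g z) \<le> 1"
    and gq: "\<And>z. z \<in> ball 0 1 \<Longrightarrow> (1 - (cmod z)\<^sup>2) * (cmod (g z))\<^sup>2 \<le> q2 * (1 - (cmod (f z))\<^sup>2)"
    using non_rotation_factor[OF fd assms(2,3)] by metis
  \<comment> \<open>\<open>q2\<close> controls squared moduli, so the correlations themselves decay
    at the rate of its square root.\<close>
  define q where "q = sqrt q2"
  have q: "0 \<le> q" "q < 1" using q2 by (auto simp: q_def)
  define F where "F n = f ^^ n" for n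
  have Fd: "F n holomorphic_on ball 0 1" "F n ` ball 0 1 \<subseteq> ball 0 1" for n
    using funpow_disc[OF fd] by (auto simp: F_def)
  have Fh: "hinf (F n)" for n by (rule hinf_self_map[OF Fd])
  have F1: "AE \<xi> in circle_measure. cmod (boundary_value (F n) \<xi>) = 1" for n
    unfolding F_def by (rule inner_funpow[OF assms(1,2)])
  have main: "(\<integral>\<^sup>+ \<xi>. ennreal ((cmod (\<Sum>n=1..N. a n * (radial_limit (F n) \<xi> - F n z)))\<^sup>2
                      * poisson_kernel z \<xi>) \<partial>circle_measure)
       \<le> ennreal (2 / (1 - q) * (\<Sum>n=1..N. (cmod (a n))\<^sup>2 * (1 - (cmod (F n z))\<^sup>2)))"
    if z: "z \<in> ball 0 1" for N :: nat and a :: "nat \<Rightarrow> complex" and z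
  proof -
    let ?P = "\<lambda>\<xi>. complex_of_real (poisson_kernel z \<xi>)"
    define B where "B n = 1 - (cmod (F n z))\<^sup>2" for n
    have B0: "0 \<le> B n" for n
      using Fd(2)[of n] z by (force simp: B_def abs_square_le_1)
    define d where "d n \<xi> = boundary_value (F n) \<xi> - F n z" for n \<xi>
    have db: "ess_bounded (d n)" for n
      unfolding d_def by (intro ess_bounded_intros Fh)
    define I where "I n k = (LINT \<xi>|circle_measure. d n \<xi> * cnj (d k \<xi>) * ?P \<xi>)" for n k
    have I_le_aux: "cmod (I n k) \<le> q ^ (n - k) * (sqrt (B n) * sqrt (B k))" if kn: "k \<le> n" for n k
    proof -
      define H where "H w = (\<Prod>i=k..<n. g (F i w))" for w
      have Hh: "hinf H"
        unfolding H_def by (intro hinf_intros hinf_compose[OF _ Fd] hinfI[OF g g1])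
      have "I n k = complex_of_real (B k) * H z"
        unfolding I_def d_def B_def
        using funpow_factor(1)[OF fd(2) q2(1) fg gq _ kn]
        by (subst correlation_inner_multiple[OF Fh F1 Hh Fh _ z]) (simp_all add: F_def H_def)
      \<comment> \<open>One factor \<open>B k\<close> is set aside for the geometric mean; the other
        one, together with \<open>|H z|^2\<close>, is what the telescoped inequality bounds by
        \<open>q2 ^ (n - k) * B n\<close>.\<close>
      then have "(cmod (I n k))\<^sup>2 = B k * (B k * (cmod (H z))\<^sup>2)"
        using B0[of k] by (simp add: norm_mult power_mult_distrib power2_eq_square mult_ac)
      also have "\<dots> \<le> B k * (q2 ^ (n - k) * B n)"
        using funpow_factor(2)[OF fd(2) q2(1) fg gq z kn] B0
        by (intro mult_left_mono) (simp_all add: B_def F_def H_def)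
      also have "\<dots> = (q ^ (n - k) * (sqrt (B n) * sqrt (B k)))\<^sup>2"
      proof -
        have "(q ^ (n - k))\<^sup>2 = (q\<^sup>2) ^ (n - k)" by (metis mult.commute power_mult)
        also have "q\<^sup>2 = q2" using q2 by (simp add: q_def)
        finally show ?thesis using B0 by (simp add: power_mult_distrib mult_ac)
      qed
      finally show ?thesis
        by (rule power2_le_imp_le) (use q B0 in auto)
    qed
    have I_le: "cmod (I n k) \<le> q ^ ((n - k) + (k - n)) * (sqrt (B n) * sqrt (B k))" for n k
    proof (cases "k \<le> n")
      case True
      then show ?thesis using I_le_aux[OF True] by simp
    next
      case False
      \<comment> \<open>The correlation matrix is Hermitian because the Poisson kernel is real,
        which reduces \<open>k > n\<close> to the case already treated.\<close>
      have "I n k = cnj (I k n)"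
        unfolding I_def Bochner_Integration.integral_cnj[symmetric]
        by (simp only: complex_cnj_mult complex_cnj_cnj complex_cnj_complex_of_real mult.commute[of "cnj (d k _)"])
      then have "cmod (I n k) = cmod (I k n)" by simp
      then show ?thesis using I_le_aux[of n k] False by (simp add: mult.commute)
    qed
    define S where "S \<xi> = (\<Sum>n=1..N. a n * d n \<xi>)" for \<xi>
    have Sb: "ess_bounded S"
      unfolding S_def by (intro ess_bounded_intros db)
    define V where "V = (LINT \<xi>|circle_measure. (cmod (S \<xi>))\<^sup>2 * poisson_kernel z \<xi>)"
    have SP: "S \<xi> * cnj (S \<xi>) * ?P \<xi> = of_real ((cmod (S \<xi>))\<^sup>2 * poisson_kernel z \<xi>)" for \<xi>
      by (simp add: complex_norm_square del: of_real_power)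
    have "integrable circle_measure (\<lambda>\<xi>. S \<xi> * cnj (S \<xi>) * ?P \<xi>)"
      by (intro ess_bounded_integrable ess_bounded_intros Sb z)
    then have int: "integrable circle_measure (\<lambda>\<xi>. (cmod (S \<xi>))\<^sup>2 * poisson_kernel z \<xi>)"
      unfolding SP complex_of_real_integrable_eq .
    have "complex_of_real V = (LINT \<xi>|circle_measure. S \<xi> * cnj (S \<xi>) * ?P \<xi>)"
      unfolding V_def SP by (rule integral_complex_of_real[symmetric])
    also have "\<dots> = (LINT \<xi>|circle_measure. (\<Sum>n=1..N. \<Sum>k=1..N. (a n * cnj (a k)) * (d n \<xi> * cnj (d k \<xi>) * ?P \<xi>)))"
      unfolding S_def cnj_sum sum_product unfolding sum_distrib_right
      by (intro Bochner_Integration.integral_cong sum.cong refl) (simp add: mult_ac)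
    also have "\<dots> = (\<Sum>n=1..N. LINT \<xi>|circle_measure. (\<Sum>k=1..N. (a n * cnj (a k)) * (d n \<xi> * cnj (d k \<xi>) * ?P \<xi>)))"
      by (intro Bochner_Integration.integral_sum ess_bounded_integrable ess_bounded_intros db z)
    also have "\<dots> = (\<Sum>n=1..N. \<Sum>k=1..N. LINT \<xi>|circle_measure. (a n * cnj (a k)) * (d n \<xi> * cnj (d k \<xi>) * ?P \<xi>))"
      by (intro sum.cong refl Bochner_Integration.integral_sum ess_bounded_integrable ess_bounded_intros db z)
    also have "\<dots> = (\<Sum>n=1..N. \<Sum>k=1..N. (a n * cnj (a k)) * I n k)"
      by (simp add: I_def)
    finally have V: "complex_of_real V = \<dots>" .
    \<comment> \<open>The geometric mean of \<open>B n\<close> and \<open>B k\<close> is divided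
      between the two indices, so that the squares of \<open>x\<close> sum to the right-hand side of
      the claim.\<close>
    define x where "x n = cmod (a n) * sqrt (B n)" for n
    have "V \<le> cmod (complex_of_real V)" by simp
    also have "\<dots> \<le> (\<Sum>n=1..N. \<Sum>k=1..N. q ^ ((n - k) + (k - n)) * (x n * x k))"
      unfolding V
    proof (intro sum_norm_le)
      fix n k
      have "cmod (a n * cnj (a k) * I n k) \<le> (cmod (a n) * cmod (a k)) * (q ^ ((n - k) + (k - n)) * (sqrt (B n) * sqrt (B k)))"
        unfolding norm_mult complex_mod_cnj by (intro mult_left_mono I_le) auto
      then show "cmod (a n * cnj (a k) * I n k) \<le> q ^ ((n - k) + (k - n)) * (x n * x k)"
        by (simp add: x_def mult_ac)
    qed
    also have "\<dots> \<le> 2 / (1 - q) * (\<Sum>n=1..N. (x n)\<^sup>2)"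
      by (intro schur_test_geometric q) auto
    also have "(\<Sum>n=1..N. (x n)\<^sup>2) = (\<Sum>n=1..N. (cmod (a n))\<^sup>2 * B n)"
      using B0 by (simp add: x_def power_mult_distrib)
    finally have V_le: "V \<le> 2 / (1 - q) * (\<Sum>n=1..N. (cmod (a n))\<^sup>2 * B n)" .
    \<comment> \<open>Countably many null sets are discarded at once, which replaces the radial
      limits by their measurable versions inside the integral.\<close>
    have "AE \<xi> in circle_measure. \<forall>n. radial_limit (F n) \<xi> = boundary_value (F n) \<xi>"
      unfolding AE_all_countable by (intro allI AE_tendsto_boundary_value Fh)
    then have "(\<integral>\<^sup>+ \<xi>. ennreal ((cmod (\<Sum>n=1..N. a n * (radial_limit (F n) \<xi> - F n z)))\<^sup>2
                      * poisson_kernel z \<xi>) \<partial>circle_measure)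
       = (\<integral>\<^sup>+ \<xi>. ennreal ((cmod (S \<xi>))\<^sup>2 * poisson_kernel z \<xi>) \<partial>circle_measure)"
      by (intro nn_integral_cong_AE) (auto simp: S_def d_def elim!: eventually_mono)
    also have "\<dots> = ennreal V"
      unfolding V_def using poisson_kernel_nonneg[OF z] by (intro nn_integral_eq_integral int) auto
    also have "\<dots> \<le> ennreal (2 / (1 - q) * (\<Sum>n=1..N. (cmod (a n))\<^sup>2 * B n))"
      by (intro ennreal_leI V_le)
    finally show ?thesis unfolding B_def .
  qed
  show ?thesis
    using main q by (intro exI[of _ "2 / (1 - q)"]) (simp add: F_def)
qed

end
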